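(* Let $M$ be a smooth manifold and let $\Lambda\subset J^1M$ be a closed Legendrian submanifold that has a frontwise doubly extendable Reeb chord of height $h$. Then $$2h\le w\left((\mathbb{R}\times\Lambda)_{-\infty}^0\right).$$
   Context: Let $M$ be an $n$-manifold. $J^1M=T^*M\times\mathbb{R}$ carries the contact form $\alpha=dz-\lambda_{can}$, where $z$ is the coordinate on $\mathbb{R}$ and $\lambda_{can}$ is the canonical 1-form on $T^*M$. The symplectization is $(\mathbb{R}\times J^1M,\,d(e^s\alpha))$. A Legendrian $\Lambda\subset J^1M$ is an $n$-dimensional submanifold tangent to $\ker\alpha$. A Reeb chord $\gamma$ of $\Lambda$ is an integral curve of the Reeb field $\partial_z$ with both endpoints on $\Lambda$; its height is $h(\gamma)=\int_\gamma\alpha$. Let $\pi_x:J^1M\to M$ and $\pi_z:J^1M\to\mathbb{R}$ be the projections; the front projection is $\pi_{xz}:J^1M\to M\times\mathbb{R}$. **Frontwise doubly extendable.** Let $\gamma$ be a Reeb chord of $\Lambda\subset J^1M$ whose endpoints are disjoint from the preimages of all singularities of the front projection of $\Lambda$. Write $\pi_x(\gamma)=x_0$, $\pi_z(\gamma)=[z_-,z_+]$, $h=z_+-z_-$, and set $Z_-=[z_--h,z_+]$, $Z_+=[z_-,z_++h]$. Then $\gamma$ is frontwise doubly extendable if either $\pi_{xz}^{-1}(\{x_0\}\times Z_-)\cap\Lambda=\Lambda\cap\partial\gamma$ or $\pi_{xz}^{-1}(\{x_0\}\times Z_+)\cap\Lambda=\Lambda\cap\partial\gamma$. **Relative Gromov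 width.** $(\mathbb{R}\times\Lambda)_{-\infty}^0=(-\infty,0)\times\Lambda$, and $w((\mathbb{R}\times\Lambda)_{-\infty}^0)$ is the supremum of $\pi r^2$ over all symplectic embeddings $\psi$ of the closed ball $(B^{2n+2}(r),\omega_0)$ of radius $r$ into $((-\infty,0)\times J^1M,d(e^s\alpha))$ with $\psi^{-1}((-\infty,0)\times\Lambda)=B^{2n+2}(r)\cap\mathbb{R}^{n+1}$, where $\mathbb{R}^{n+1}\subset\mathbb{R}^{2n+2}$ is a Lagrangian plane. *)

theory Defs
  imports "HOL-Analysis.Analysis"
begin

section \<open>Smooth maps between Euclidean spaces\<close>

text \<open>Both notions below are only used for open sets.\<close>

primrec Ck_on :: "nat \<Rightarrow> 'a::euclidean_space set \<Rightarrow> ('a \<Rightarrow> 'b::real_normed_vector) \<Rightarrow> bool" where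
  "Ck_on 0 S f \<longleftrightarrow> continuous_on S f"
| "Ck_on (Suc k) S f \<longleftrightarrow>
     (\<forall>x\<in>S. f differentiable (at x)) \<and>
     (\<forall>v. Ck_on k S (\<lambda>x. frechet_derivative f (at x) v))"

definition smooth_on :: "'a::euclidean_space set \<Rightarrow> ('a \<Rightarrow> 'b::real_normed_vector) \<Rightarrow> bool" where
  "smooth_on S f \<longleftrightarrow> (\<forall>k. Ck_on k S f)"


section \<open>Smooth manifolds\<close>

text \<open>A chart is a pair of its domain and its coordinate map (whose values outside the domain
  are irrelevant).  A manifold is given by a smooth atlas, not necessarily maximal: its points are
  those of the chart domains, and it carries the topology that the charts induce.  It has no
  boundary, need not be connected, and its dimension is \<open>DIM('e)\<close>.\<close>

type_synonym ('m, 'e) chart = "'m set \<times> ('m \<Rightarrow> 'e)"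

definition carrier :: "('m, 'e) chart set \<Rightarrow> 'm set" where
  "carrier A = (\<Union>c\<in>A. fst c)"

definition manifold_topology :: "('m, 'e::euclidean_space) chart set \<Rightarrow> 'm topology" where
  "manifold_topology A =
     topology_generated_by {{x \<in> fst c. snd c x \<in> W} | c W. c \<in> A \<and> open W}"

definition is_chart :: "('m, 'e::euclidean_space) chart \<Rightarrow> bool" where
  "is_chart c \<longleftrightarrow> inj_on (snd c) (fst c) \<and> open (snd c ` fst c)"

definition transition :: "('m, 'e) chart \<Rightarrow> ('m, 'e) chart \<Rightarrow> 'e \<Rightarrow> 'e" where
  "transition c d = snd d \<circ> inv_into (fst c) (snd c)"

definition smooth_transition ::
  "('m, 'e::euclidean_space) chart \<Rightarrow> ('m, 'e) chart \<Rightarrow> bool" where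
  "smooth_transition c d \<longleftrightarrow>
     open (snd c ` (fst c \<inter> fst d)) \<and> smooth_on (snd c ` (fst c \<inter> fst d)) (transition c d)"

definition smooth_manifold :: "('m, 'e::euclidean_space) chart set \<Rightarrow> bool" where
  "smooth_manifold A \<longleftrightarrow>
     (\<forall>c\<in>A. is_chart c) \<and> (\<forall>c\<in>A. \<forall>d\<in>A. smooth_transition c d) \<and>
     Hausdorff_space (manifold_topology A) \<and> second_countable (manifold_topology A)"

text \<open>The members of the maximal atlas.\<close>

definition compatible_chart ::
  "('m, 'e::euclidean_space) chart set \<Rightarrow> ('m, 'e) chart \<Rightarrow> bool" where
  "compatible_chart A c \<longleftrightarrow> is_chart c \<and> fst c \<subseteq> carrier A \<and>
     (\<forall>d\<in>A. smooth_transition c d \<and> smooth_transition d c)"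

text \<open>Embedded submanifolds of dimension \<open>k\<close>, by slice charts.\<close>

definition embedded_submanifold ::
  "('m, 'e::euclidean_space) chart set \<Rightarrow> nat \<Rightarrow> 'm set \<Rightarrow> bool" where
  "embedded_submanifold A k S \<longleftrightarrow> S \<subseteq> carrier A \<and>
     (\<forall>x\<in>S. \<exists>c L. compatible_chart A c \<and> x \<in> fst c \<and> subspace L \<and> dim L = k \<and>
        snd c ` (fst c \<inter> S) = snd c ` fst c \<inter> L)"

text \<open>Smooth maps from an open subset of a Euclidean space into a manifold.\<close>

definition smooth_into ::
  "('m, 'e::euclidean_space) chart set \<Rightarrow> 'a::euclidean_space set \<Rightarrow> ('a \<Rightarrow> 'm) \<Rightarrow> bool" where
  "smooth_into A N f \<longleftrightarrow> open N \<and> f ` N \<subseteq> carrier A \<and>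
     (\<forall>c\<in>A. open {u \<in> N. f u \<in> fst c} \<and> smooth_on {u \<in> N. f u \<in> fst c} (snd c \<circ> f))"

text \<open>The tangent space at \<open>y\<close> of a submanifold \<open>S\<close>, expressed in the coordinates of a chart \<open>c\<close>:
  the velocities of the smooth curves in \<open>S\<close> through \<open>y\<close>.\<close>

definition tangent_space ::
  "('m, 'e::euclidean_space) chart set \<Rightarrow> 'm set \<Rightarrow> ('m, 'e) chart \<Rightarrow> 'm \<Rightarrow> 'e set" where
  "tangent_space A S c y =
     {v. \<exists>g \<epsilon>. \<epsilon> > 0 \<and> smooth_into A {-\<epsilon><..<\<epsilon>} g \<and> g ` {-\<epsilon><..<\<epsilon>} \<subseteq> S \<and> g 0 = y \<and>
        ((snd c \<circ> g) has_vector_derivative v) (at (0::real))}"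

definition prod_atlas ::
  "('m, 'e) chart set \<Rightarrow> ('k, 'f) chart set \<Rightarrow> ('m \<times> 'k, 'e \<times> 'f) chart set" where
  "prod_atlas A B = {(fst c \<times> fst d, map_prod (snd c) (snd d)) | c d. c \<in> A \<and> d \<in> B}"


section \<open>The cotangent bundle, the 1-jet space and its symplectization\<close>

text \<open>A covector at \<open>x\<close> is the family of its component vectors, one for each chart around \<open>x\<close>,
  that transforms like the components of a 1-form; the covector with components \<open>\<xi> c\<close> is the
  linear form \<open>v \<mapsto> \<xi> c \<bullet> v\<close> on tangent vectors written in the chart \<open>c\<close>.  Charts not around
  \<open>x\<close> get the dummy value \<open>0\<close>.\<close>

definition cotangent_space ::
  "('m, 'e::euclidean_space) chart set \<Rightarrow> 'm \<Rightarrow> (('m, 'e) chart \<Rightarrow> 'e) set" where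
  "cotangent_space A x =
     {\<xi>. (\<forall>c\<in>A. \<forall>d\<in>A. x \<in> fst c \<longrightarrow> x \<in> fst d \<longrightarrow>
            (\<forall>v. \<xi> c \<bullet> v = \<xi> d \<bullet> frechet_derivative (transition c d) (at (snd c x)) v)) \<and>
         (\<forall>c. \<not> (c \<in> A \<and> x \<in> fst c) \<longrightarrow> \<xi> c = 0)}"

type_synonym ('m, 'e) cotangent = "'m \<times> (('m, 'e) chart \<Rightarrow> 'e)"
type_synonym ('m, 'e) jet = "('m, 'e) cotangent \<times> real"

definition cotangent_atlas ::
  "('m, 'e::euclidean_space) chart set \<Rightarrow> (('m, 'e) cotangent, 'e \<times> 'e) chart set" where
  "cotangent_atlas A =
     {(Sigma (fst c) (cotangent_space A), \<lambda>(x, \<xi>). (snd c x, \<xi> c)) | c. c \<in> A}"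

definition jet_atlas ::
  "('m, 'e::euclidean_space) chart set \<Rightarrow> (('m, 'e) jet, ('e \<times> 'e) \<times> real) chart set" where
  "jet_atlas A = prod_atlas (cotangent_atlas A) {(UNIV, id)}"

text \<open>The negative half \<open>(-\<infinity>, 0) \<times> J\<^sup>1M\<close> of the symplectization.\<close>

definition neg_symplectization_atlas ::
  "('m, 'e::euclidean_space) chart set \<Rightarrow>
   (real \<times> ('m, 'e) jet, real \<times> (('e \<times> 'e) \<times> real)) chart set" where
  "neg_symplectization_atlas A = prod_atlas {({..<0}, id)} (jet_atlas A)"

text \<open>A 1-form \<open>\<theta>\<close> on an open subset of a vector space is the function taking a point \<open>u\<close> and a
  tangent vector \<open>v\<close> to \<open>\<theta> u v\<close>.  The forms below are the local expressions of \<open>\<lambda>\<^sub>c\<^sub>a\<^sub>n = p dq\<close>,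
  \<open>\<alpha> = dz - \<lambda>\<^sub>c\<^sub>a\<^sub>n\<close> and \<open>e\<^sup>s\<alpha>\<close>.  They are the same in every chart of the above atlases, since the
  transformation law of covectors makes \<open>p dq\<close> invariant.\<close>

definition canonical_form :: "'e::euclidean_space \<times> 'e \<Rightarrow> 'e \<times> 'e \<Rightarrow> real" where
  "canonical_form = (\<lambda>(q, p) (q', p'). p \<bullet> q')"

definition contact_form ::
  "('e::euclidean_space \<times> 'e) \<times> real \<Rightarrow> ('e \<times> 'e) \<times> real \<Rightarrow> real" where
  "contact_form = (\<lambda>(y, z) (y', z'). z' - canonical_form y y')"

definition symplectization_primitive ::
  "real \<times> (('e::euclidean_space \<times> 'e) \<times> real) \<Rightarrow> real \<times> (('e \<times> 'e) \<times> real) \<Rightarrow> real" where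
  "symplectization_primitive = (\<lambda>(s, u) (s', u'). exp s * contact_form u u')"

text \<open>\<open>d\<theta>(v, w) = v(\<theta>(w)) - w(\<theta>(v))\<close> for constant vector fields \<open>v\<close> and \<open>w\<close>.\<close>

definition exterior_derivative ::
  "('a::euclidean_space \<Rightarrow> 'a \<Rightarrow> real) \<Rightarrow> 'a \<Rightarrow> 'a \<Rightarrow> 'a \<Rightarrow> real" where
  "exterior_derivative \<theta> u v w =
     frechet_derivative (\<lambda>x. \<theta> x w) (at u) v - frechet_derivative (\<lambda>x. \<theta> x v) (at u) w"

definition symplectization_form ::
  "real \<times> (('e::euclidean_space \<times> 'e) \<times> real) \<Rightarrow> real \<times> (('e \<times> 'e) \<times> real) \<Rightarrow>
   real \<times> (('e \<times> 'e) \<times> real) \<Rightarrow> real" where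
  "symplectization_form = exterior_derivative symplectization_primitive"

lemma symplectization_form_eq:
  "symplectization_form (s, ((q, p), z)) (s1, ((q1, p1), z1)) (s2, ((q2, p2), z2)) =
     exp s * (s1 * (z2 - p \<bullet> q2) - s2 * (z1 - p \<bullet> q1) - (p1 \<bullet> q2 - p2 \<bullet> q1))"
proof -
  have "frechet_derivative (\<lambda>x. symplectization_primitive x (t, ((a, b), c))) (at (s, ((q, p), z))) =
      (\<lambda>h. fst h * exp s * (c - p \<bullet> a) - exp s * (snd (fst (snd h)) \<bullet> a))"
    for t c :: real and a b :: 'a
    by (rule frechet_derivative_at[symmetric])
       (auto simp: symplectization_primitive_def contact_form_def canonical_form_def split_beta
          algebra_simps intro!: derivative_eq_intros)
  then show ?thesis
    by (simp add: symplectization_form_def exterior_derivative_def algebra_simps)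
qed


section \<open>Legendrian submanifolds and Reeb chords\<close>

text \<open>\<open>A\<close> is the atlas of the base manifold \<open>M\<close> from here on.\<close>

definition legendrian ::
  "('m, 'e::euclidean_space) chart set \<Rightarrow> ('m, 'e) jet set \<Rightarrow> bool" where
  "legendrian A \<Lambda> \<longleftrightarrow> embedded_submanifold (jet_atlas A) DIM('e) \<Lambda> \<and>
     (\<forall>y\<in>\<Lambda>. \<forall>c\<in>jet_atlas A. y \<in> fst c \<longrightarrow>
        (\<forall>v\<in>tangent_space (jet_atlas A) \<Lambda> c y. contact_form (snd c y) v = 0))"

text \<open>Compact without boundary, the latter being part of \<open>embedded_submanifold\<close>.\<close>

definition closed_legendrian ::
  "('m, 'e::euclidean_space) chart set \<Rightarrow> ('m, 'e) jet set \<Rightarrow> bool" where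
  "closed_legendrian A \<Lambda> \<longleftrightarrow>
     legendrian A \<Lambda> \<and> compactin (manifold_topology (jet_atlas A)) \<Lambda>"

text \<open>Integral curves on \<open>[a, b]\<close> of a vector field that has the local expression \<open>X\<close> in each
  chart of the atlas.\<close>

definition integral_curve ::
  "('m, 'e::euclidean_space) chart set \<Rightarrow> ('e \<Rightarrow> 'e) \<Rightarrow> real \<Rightarrow> real \<Rightarrow> (real \<Rightarrow> 'm) \<Rightarrow> bool" where
  "integral_curve A X a b \<gamma> \<longleftrightarrow>
     continuous_map (top_of_set {a..b}) (manifold_topology A) \<gamma> \<and>
     (\<forall>t\<in>{a..b}. \<forall>c\<in>A. \<gamma> t \<in> fst c \<longrightarrow>
        ((snd c \<circ> \<gamma>) has_vector_derivative X (snd c (\<gamma> t))) (at t within {a..b}))"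

text \<open>\<open>\<partial>\<^sub>z\<close>\<close>

definition reeb_field ::
  "('e::euclidean_space \<times> 'e) \<times> real \<Rightarrow> ('e \<times> 'e) \<times> real" where
  "reeb_field = (\<lambda>u. (0, 1))"

definition reeb_chord ::
  "('m, 'e::euclidean_space) chart set \<Rightarrow> ('m, 'e) jet set \<Rightarrow> real \<Rightarrow> real \<Rightarrow>
   (real \<Rightarrow> ('m, 'e) jet) \<Rightarrow> bool" where
  "reeb_chord A \<Lambda> a b \<gamma> \<longleftrightarrow>
     a < b \<and> integral_curve (jet_atlas A) reeb_field a b \<gamma> \<and> \<gamma> a \<in> \<Lambda> \<and> \<gamma> b \<in> \<Lambda>"

text \<open>The integral over \<open>\<gamma>\<close> of a 1-form that has the local expression \<open>\<theta>\<close> in each chart of the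
  atlas; the integrand does not depend on the choice of the chart.\<close>

definition line_integral ::
  "('m, 'e::euclidean_space) chart set \<Rightarrow> ('e \<Rightarrow> 'e \<Rightarrow> real) \<Rightarrow> real \<Rightarrow> real \<Rightarrow>
   (real \<Rightarrow> 'm) \<Rightarrow> real" where
  "line_integral A \<theta> a b \<gamma> =
     integral {a..b} (\<lambda>t. let c = (SOME c. c \<in> A \<and> \<gamma> t \<in> fst c) in
        \<theta> (snd c (\<gamma> t)) (vector_derivative (snd c \<circ> \<gamma>) (at t within {a..b})))"

definition chord_height ::
  "('m, 'e::euclidean_space) chart set \<Rightarrow> real \<Rightarrow> real \<Rightarrow> (real \<Rightarrow> ('m, 'e) jet) \<Rightarrow> real" where
  "chord_height A a b \<gamma> = line_integral (jet_atlas A) contact_form a b \<gamma>"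


section \<open>The front projection\<close>

definition proj_x :: "('a \<times> 'b) \<times> real \<Rightarrow> 'a" where
  "proj_x y = fst (fst y)"

definition proj_z :: "('a \<times> 'b) \<times> real \<Rightarrow> real" where
  "proj_z y = snd y"

text \<open>Polymorphic, because this is the projection \<open>J\<^sup>1M \<rightarrow> M \<times> \<real>\<close> and also its expression
  \<open>((q, p), z) \<mapsto> (q, z)\<close> in the charts of \<open>jet_atlas\<close>, where it is linear and hence is its own
  derivative.\<close>

definition front_proj :: "('a \<times> 'b) \<times> real \<Rightarrow> 'a \<times> real" where
  "front_proj y = (proj_x y, proj_z y)"

text \<open>The points of the front that are critical values of the front projection of \<open>\<Lambda>\<close>, that is,
  images of points where its restriction to \<open>\<Lambda>\<close> is not an immersion.\<close>

definition front_singularities ::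
  "('m, 'e::euclidean_space) chart set \<Rightarrow> ('m, 'e) jet set \<Rightarrow> ('m \<times> real) set" where
  "front_singularities A \<Lambda> =
     front_proj ` {y \<in> \<Lambda>. \<exists>c\<in>jet_atlas A. y \<in> fst c \<and>
        (\<exists>v\<in>tangent_space (jet_atlas A) \<Lambda> c y. v \<noteq> 0 \<and> front_proj v = 0)}"

definition frontwise_doubly_extendable ::
  "('m, 'e::euclidean_space) chart set \<Rightarrow> ('m, 'e) jet set \<Rightarrow> real \<Rightarrow> real \<Rightarrow>
   (real \<Rightarrow> ('m, 'e) jet) \<Rightarrow> bool" where
  "frontwise_doubly_extendable A \<Lambda> a b \<gamma> \<longleftrightarrow>
     reeb_chord A \<Lambda> a b \<gamma> \<and>
     {\<gamma> a, \<gamma> b} \<inter> front_proj -` front_singularities A \<Lambda> = {} \<and>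
     (\<exists>x0 zm zp. proj_x ` \<gamma> ` {a..b} = {x0} \<and> zm \<le> zp \<and> proj_z ` \<gamma> ` {a..b} = {zm..zp} \<and>
        (let h = zp - zm in
           front_proj -` ({x0} \<times> {zm - h..zp}) \<inter> \<Lambda> = \<Lambda> \<inter> {\<gamma> a, \<gamma> b} \<or>
           front_proj -` ({x0} \<times> {zm..zp + h}) \<inter> \<Lambda> = \<Lambda> \<inter> {\<gamma> a, \<gamma> b}))"


section \<open>The relative Gromov width\<close>

text \<open>With \<open>n = DIM('e)\<close>, the space \<open>\<real>\<^sup>2\<^sup>n\<^sup>+\<^sup>2\<close> is \<open>V \<times> V\<close> for \<open>V = \<real>\<^sup>n \<times> \<real>\<close>, with
  \<open>\<omega>\<^sub>0 = \<Sum>\<^sub>i dx\<^sub>i \<and> dy\<^sub>i\<close>, and the Lagrangian plane is \<open>y = 0\<close>.\<close>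

definition standard_symplectic_form :: "'v::euclidean_space \<times> 'v \<Rightarrow> 'v \<times> 'v \<Rightarrow> real" where
  "standard_symplectic_form = (\<lambda>(x, y) (x', y'). x \<bullet> y' - y \<bullet> x')"

definition real_plane :: "('v::euclidean_space \<times> 'v) set" where
  "real_plane = {(x, y). y = 0}"

text \<open>A map on the closed ball is smooth if it extends smoothly to a neighbourhood.  It is an
  embedding once it is injective and symplectic, as it is then an immersion of a compact space.\<close>

definition symplectic_ball_embedding ::
  "('m, 'e::euclidean_space) chart set \<Rightarrow> real \<Rightarrow>
   (('e \<times> real) \<times> ('e \<times> real) \<Rightarrow> real \<times> ('m, 'e) jet) \<Rightarrow> bool" where
  "symplectic_ball_embedding A r \<psi> \<longleftrightarrow>
     (\<exists>N. cball 0 r \<subseteq> N \<and> smooth_into (neg_symplectization_atlas A) N \<psi>) \<and>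
     inj_on \<psi> (cball 0 r) \<and>
     (\<forall>u\<in>cball 0 r. \<forall>c\<in>neg_symplectization_atlas A. \<psi> u \<in> fst c \<longrightarrow>
        (\<forall>v w. symplectization_form (snd c (\<psi> u))
                 (frechet_derivative (snd c \<circ> \<psi>) (at u) v)
                 (frechet_derivative (snd c \<circ> \<psi>) (at u) w) =
               standard_symplectic_form v w))"

definition relative_gromov_width ::
  "('m, 'e::euclidean_space) chart set \<Rightarrow> ('m, 'e) jet set \<Rightarrow> ereal" where
  "relative_gromov_width A \<Lambda> =
     Sup {ereal (pi * r\<^sup>2) | r. r > 0 \<and>
       (\<exists>\<psi>. symplectic_ball_embedding A r \<psi> \<and>
            {u \<in> cball 0 r. \<psi> u \<in> {..<0} \<times> \<Lambda>} = cball 0 r \<inter> real_plane)}"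

end

theory Submission
  imports Defs
begin

text \<open>With \<open>t = exp s\<close> and \<open>P = t p\<close> the symplectization form becomes \<open>dt \<and> dz + dq \<and> dP\<close> on
  \<open>0 < t < 1\<close>, with \<open>q\<close> in a chart and \<open>P\<close> unrestricted.  Let \<open>y0\<close> be the end of the chord whose
  fiber of the front meets \<open>\<Lambda>\<close> nowhere else at distance less than \<open>h\<close>.  The front is immersed at
  \<open>y0\<close>, so near \<open>y0\<close> the Legendrian is the 1-jet of a function \<open>f\<close>, and the shear
  \<open>Z = z - f q\<close>, \<open>P' = P - t df\<close> straightens the Lagrangian to \<open>Z = 0, P' = 0\<close>.  The rectangle
  \<open>0 < t < 1\<close>, \<open>-h < Z < h\<close> has area \<open>2 h\<close>, so it contains every disk of smaller area, with the
  diameter on \<open>Z = 0\<close>; the remaining coordinates are scaled by \<open>q = q0 + \<epsilon> x\<close>, \<open>P' = y / \<epsilon>\<close> with \<open>\<epsilon>\<close>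
  so small that, by compactness, no other part of \<open>\<Lambda>\<close> is met.\<close>

section \<open>Smooth maps between Euclidean spaces\<close>

text \<open>Only the plane of \<open>t\<close> and \<open>z\<close> limits the ball:
  \<open>s < 0\<close> confines \<open>t\<close> to an interval of length 1, while the covector
  directions are unbounded, so shrinking the base directions costs nothing. The \<open>z\<close>
  direction offers \<open>2 * h\<close> rather than \<open>h\<close> because each interval in the
  definition of double extendability has length \<open>2 * h\<close> and one end of the chord as its
  midpoint. That end is \<open>y0\<close>; the other end lies at distance exactly \<open>h\<close>,
  on the edge of the rectangle. The shear is symplectic because the term dt \<and> df produced by
  \<open>Z\<close> cancels the term df \<and> dt produced by \<open>P'\<close>, and the Hessian of
  \<open>f\<close> drops out by symmetry. The embedding is written in one chart of the base, but the
  definition tests it in all charts. Hence the preparations: p dq does not depend on the chart, and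
  the exterior derivative commutes with pullback, which rests on the symmetry of second derivatives.
  Checking that a map is symplectic then reduces to computing one pulled-back primitive.\<close>

abbreviation fd :: "('a::euclidean_space \<Rightarrow> 'b::real_normed_vector) \<Rightarrow> 'a \<Rightarrow> 'a \<Rightarrow> 'b" where
  "fd f x v \<equiv> frechet_derivative f (at x) v"

lemma fd_eq: "(f has_derivative f') (at x) \<Longrightarrow> fd f x v = f' v"
  using frechet_derivative_at by metis

lemma fd_cong_open:
  assumes "open S" "x \<in> S" "\<And>y. y \<in> S \<Longrightarrow> f y = g y"
  shows "frechet_derivative f (at x) = frechet_derivative g (at x)"
proof -
  have "(f has_derivative D) (at x) \<longleftrightarrow> (g has_derivative D) (at x)" for D
    using has_derivative_transform_within_open[OF _ assms(1,2), of f D UNIV g]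
      has_derivative_transform_within_open[OF _ assms(1,2), of g D UNIV f] assms(3) by auto
  then show ?thesis by (simp add: frechet_derivative_def)
qed

lemma Ck_on_cong:
  assumes "open S" "\<And>x. x \<in> S \<Longrightarrow> f x = g x" "Ck_on k S f"
  shows "Ck_on k S g"
  using assms(2,3)
proof (induction k arbitrary: f g)
  case 0
  then show ?case using continuous_on_cong[of S S f g] by simp
next
  case (Suc k)
  have "g differentiable (at x)" if "x \<in> S" for x
  proof -
    from Suc.prems(2) that have "f differentiable (at x)" by simp
    then obtain D where "(f has_derivative D) (at x)" by (auto simp: differentiable_def)
    then have "(g has_derivative D) (at x)"
      using has_derivative_transform_within_open[OF _ assms(1) that, of f D UNIV g] Suc.prems(1)
      by auto
    then show ?thesis by (auto simp: differentiable_def)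
  qed
  moreover have "Ck_on k S (\<lambda>x. fd g x v)" for v
  proof (rule Suc.IH)
    show "Ck_on k S (\<lambda>x. fd f x v)" using Suc.prems(2) by simp
    show "fd f x v = fd g x v" if "x \<in> S" for x
      using fd_cong_open[OF assms(1) that Suc.prems(1)] by simp
  qed
  ultimately show ?case by simp
qed

lemma Ck_on_subset: "Ck_on k S f \<Longrightarrow> T \<subseteq> S \<Longrightarrow> Ck_on k T f"
  by (induction k arbitrary: f) (auto intro: continuous_on_subset)

text \<open>Accepts any explicit derivative, so each closure property below becomes an induction
  that only has to recognise a derivative formula as built from maps of order
  \<open>k\<close>.\<close>

lemma Ck_on_SucI:
  assumes "open S" "\<And>x. x \<in> S \<Longrightarrow> (f has_derivative f' x) (at x)"
    and "\<And>v. Ck_on k S (\<lambda>x. f' x v)"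
  shows "Ck_on (Suc k) S f"
proof -
  have "Ck_on k S (\<lambda>x. fd f x v)" for v
    by (rule Ck_on_cong[OF assms(1) _ assms(3)]) (simp add: fd_eq[OF assms(2)])
  then show ?thesis using assms(2) by (auto simp: differentiable_def)
qed

lemma Ck_on_has_derivative:
  assumes "Ck_on (Suc k) S f" "x \<in> S"
  shows "(f has_derivative (fd f x)) (at x)"
  using assms by (simp add: frechet_derivative_works[symmetric])

lemma Ck_on_Suc_imp: "Ck_on (Suc k) S f \<Longrightarrow> Ck_on k S f"
proof (induction k arbitrary: f)
  case 0
  then show ?case
    by (auto intro!: continuous_at_imp_continuous_on differentiable_imp_continuous_within)
next
  case (Suc k)
  have "Ck_on k S (\<lambda>x. fd f x v)" for v
    by (rule Suc.IH) (use Suc.prems in simp)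
  with Suc.prems show ?case by simp
qed

lemma Ck_on_const: "Ck_on k S (\<lambda>x. c)"
proof (induction k arbitrary: c)
  case (Suc k)
  have "(\<lambda>x. fd (\<lambda>x. c) x v) = (\<lambda>x. 0)" for v
    by (simp add: fun_eq_iff fd_eq)
  with Suc show ?case by simp
qed simp

lemma Ck_on_bounded_linear:
  assumes "open S" "bounded_linear L"
  shows "Ck_on k S f \<Longrightarrow> Ck_on k S (\<lambda>x. L (f x))"
proof (induction k arbitrary: f)
  case 0
  then show ?case using bounded_linear.continuous_on[OF assms(2)] by simp
next
  case (Suc k)
  show ?case
  proof (rule Ck_on_SucI[OF assms(1)])
    show "((\<lambda>x. L (f x)) has_derivative (\<lambda>v. L (fd f x v))) (at x)" if "x \<in> S" for x
      using bounded_linear.has_derivative[OF assms(2) Ck_on_has_derivative[OF Suc.prems that]] .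
    show "Ck_on k S (\<lambda>x. L (fd f x v))" for v
      by (rule Suc.IH) (use Suc.prems in simp)
  qed
qed

lemma Ck_on_id: "open S \<Longrightarrow> Ck_on k S (\<lambda>x. x)"
  by (cases k) (auto simp del: Ck_on.simps(2) intro!: Ck_on_SucI[where f' = "\<lambda>x v. v"] Ck_on_const)

lemma Ck_on_add:
  assumes "open S"
  shows "Ck_on k S f \<Longrightarrow> Ck_on k S g \<Longrightarrow> Ck_on k S (\<lambda>x. f x + g x)"
proof (induction k arbitrary: f g)
  case 0
  then show ?case by (simp add: continuous_on_add)
next
  case (Suc k)
  show ?case
  proof (rule Ck_on_SucI[OF assms])
    show "((\<lambda>x. f x + g x) has_derivative (\<lambda>v. fd f x v + fd g x v)) (at x)" if "x \<in> S" for x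
      using Ck_on_has_derivative[OF Suc.prems(1) that] Ck_on_has_derivative[OF Suc.prems(2) that]
      by (rule has_derivative_add)
    show "Ck_on k S (\<lambda>x. fd f x v + fd g x v)" for v
      by (rule Suc.IH) (use Suc.prems in simp_all)
  qed
qed

lemma Ck_on_sum:
  assumes "open S" "finite I" "\<And>i. i \<in> I \<Longrightarrow> Ck_on k S (f i)"
  shows "Ck_on k S (\<lambda>x. \<Sum>i\<in>I. f i x)"
  using assms(2,3)
  by (induction I rule: finite_induct) (auto intro!: Ck_on_const Ck_on_add[OF assms(1)])

lemma Ck_on_bilinear:
  assumes "open S" "bounded_bilinear B"
  shows "Ck_on k S f \<Longrightarrow> Ck_on k S g \<Longrightarrow> Ck_on k S (\<lambda>x. B (f x) (g x))"
proof (induction k arbitrary: f g)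
  case 0
  then show ?case using bounded_bilinear.continuous_on[OF assms(2)] by simp
next
  case (Suc k)
  show ?case
  proof (rule Ck_on_SucI[OF assms(1)])
    show "((\<lambda>x. B (f x) (g x)) has_derivative (\<lambda>v. B (f x) (fd g x v) + B (fd f x v) (g x))) (at x)"
      if "x \<in> S" for x
      using bounded_bilinear.FDERIV[OF assms(2) Ck_on_has_derivative[OF Suc.prems(1) that]
          Ck_on_has_derivative[OF Suc.prems(2) that]] .
    show "Ck_on k S (\<lambda>x. B (f x) (fd g x v) + B (fd f x v) (g x))" for v
      by (intro Ck_on_add[OF assms(1)] Suc.IH Ck_on_Suc_imp[OF Suc.prems(1)]
          Ck_on_Suc_imp[OF Suc.prems(2)]) (use Suc.prems in simp_all)
  qed
qed

lemma linear_basis_expansion: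
  fixes v :: "'a::euclidean_space"
  assumes "linear L"
  shows "L v = (\<Sum>b\<in>Basis. (v \<bullet> b) *\<^sub>R L b)"
proof -
  have "L v = L (\<Sum>b\<in>Basis. (v \<bullet> b) *\<^sub>R b)" by (simp add: euclidean_representation)
  also have "\<dots> = (\<Sum>b\<in>Basis. (v \<bullet> b) *\<^sub>R L b)"
    by (simp add: linear_sum[OF assms] linear_scale[OF assms])
  finally show ?thesis .
qed

lemma Ck_on_compose:
  fixes f :: "'a::euclidean_space \<Rightarrow> 'b::euclidean_space"
  assumes "open S" "open T" "f ` S \<subseteq> T"
  shows "Ck_on k S f \<Longrightarrow> Ck_on k T g \<Longrightarrow> Ck_on k S (\<lambda>x. g (f x))"
  using assms(3)
proof (induction k arbitrary: f g)
  case 0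
  then show ?case using continuous_on_compose2[of T g S f] by simp
next
  case (Suc k)
  have dg: "(g has_derivative fd g (f x)) (at (f x))" if "x \<in> S" for x
    using Ck_on_has_derivative[OF Suc.prems(2)] that Suc.prems(3) by blast
  show ?case
  proof (rule Ck_on_SucI[OF assms(1)])
    show "((\<lambda>x. g (f x)) has_derivative (\<lambda>v. fd g (f x) (fd f x v))) (at x)" if "x \<in> S" for x
      using has_derivative_compose[OF Ck_on_has_derivative[OF Suc.prems(1) that] dg[OF that]] .
    show "Ck_on k S (\<lambda>x. fd g (f x) (fd f x v))" for v
    proof (rule Ck_on_cong[OF assms(1)])
      \<comment> \<open>In the chain rule the direction \<open>fd f x v\<close> moves with
        \<open>x\<close>, while \<open>Ck_on\<close> speaks of fixed directions; the basis expansion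
        leaves only fixed ones.\<close>
      show "Ck_on k S (\<lambda>x. \<Sum>b\<in>Basis. (fd f x v \<bullet> b) *\<^sub>R fd g (f x) b)"
      proof (intro Ck_on_sum Ck_on_bilinear[OF assms(1) bounded_bilinear_scaleR] assms(1))
        show "Ck_on k S (\<lambda>x. fd f x v \<bullet> b)" for b
          using Suc.prems(1) by (intro Ck_on_bounded_linear[OF assms(1) bounded_linear_inner_left]) simp
        show "Ck_on k S (\<lambda>x. fd g (f x) b)" for b
          by (rule Suc.IH[OF Ck_on_Suc_imp[OF Suc.prems(1)]]) (use Suc.prems in simp_all)
      qed simp
      show "(\<Sum>b\<in>Basis. (fd f x v \<bullet> b) *\<^sub>R fd g (f x) b) = fd g (f x) (fd f x v)" if "x \<in> S" for x
        by (rule linear_basis_expansion[OF has_derivative_linear[OF dg[OF that]], symmetric])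
    qed
  qed
qed

section \<open>Closure properties of smooth maps\<close>

lemma smooth_on_cong:
  "open S \<Longrightarrow> (\<And>x. x \<in> S \<Longrightarrow> f x = g x) \<Longrightarrow> smooth_on S f \<Longrightarrow> smooth_on S g"
  unfolding smooth_on_def using Ck_on_cong by blast

lemma smooth_on_subset: "smooth_on S f \<Longrightarrow> T \<subseteq> S \<Longrightarrow> smooth_on T f"
  unfolding smooth_on_def using Ck_on_subset by blast

lemma smooth_on_has_derivative:
  "smooth_on S f \<Longrightarrow> x \<in> S \<Longrightarrow> (f has_derivative (fd f x)) (at x)"
  unfolding smooth_on_def using Ck_on_has_derivative by blast

lemma smooth_on_fd:
  assumes "smooth_on S f"
  shows "smooth_on S (\<lambda>x. fd f x v)"
proof -
  have "Ck_on (Suc k) S f" for k using assms by (simp add: smooth_on_def del: Ck_on.simps)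
  then show ?thesis by (simp add: smooth_on_def)
qed

lemma smooth_on_linear_fd: "smooth_on S f \<Longrightarrow> x \<in> S \<Longrightarrow> linear (fd f x)"
  using smooth_on_has_derivative has_derivative_linear by blast

lemma smooth_on_continuous: "smooth_on S f \<Longrightarrow> continuous_on S f"
  by (auto simp: smooth_on_def dest: spec[of _ 0])

text \<open>For maps known through their derivative, such as a logarithm or an antiderivative: order
  \<open>k\<close> of the derivative gives order \<open>k + 1\<close> of the map, for every
  \<open>k\<close>.\<close>

lemma smooth_on_derivativeI:
  assumes "open S" "\<And>x. x \<in> S \<Longrightarrow> (f has_derivative f' x) (at x)"
    and "\<And>v. smooth_on S (\<lambda>x. f' x v)"
  shows "smooth_on S f"
proof -
  have "Ck_on (Suc k) S f" for k
    using assms by (auto intro!: Ck_on_SucI simp: smooth_on_def simp del: Ck_on.simps)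
  then show ?thesis unfolding smooth_on_def using Ck_on_Suc_imp by blast
qed

lemma smooth_on_const: "smooth_on S (\<lambda>x. c)"
  by (simp add: smooth_on_def Ck_on_const)

lemma smooth_on_id: "open S \<Longrightarrow> smooth_on S (\<lambda>x. x)"
  by (simp add: smooth_on_def Ck_on_id)

lemma smooth_on_bounded_linear:
  "open S \<Longrightarrow> bounded_linear L \<Longrightarrow> smooth_on S f \<Longrightarrow> smooth_on S (\<lambda>x. L (f x))"
  by (simp add: smooth_on_def Ck_on_bounded_linear)

lemma smooth_on_bilinear:
  "open S \<Longrightarrow> bounded_bilinear B \<Longrightarrow> smooth_on S f \<Longrightarrow> smooth_on S g \<Longrightarrow>
    smooth_on S (\<lambda>x. B (f x) (g x))"
  by (simp add: smooth_on_def Ck_on_bilinear)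

lemmas smooth_on_inner = smooth_on_bilinear[OF _ bounded_bilinear_inner]
lemmas smooth_on_scaleR = smooth_on_bilinear[OF _ bounded_bilinear_scaleR]
lemmas smooth_on_mult = smooth_on_bilinear[OF _ bounded_bilinear_mult]

lemma smooth_on_add:
  "open S \<Longrightarrow> smooth_on S f \<Longrightarrow> smooth_on S g \<Longrightarrow> smooth_on S (\<lambda>x. f x + g x)"
  by (simp add: smooth_on_def Ck_on_add)

lemma smooth_on_minus: "open S \<Longrightarrow> smooth_on S f \<Longrightarrow> smooth_on S (\<lambda>x. - f x)"
  by (rule smooth_on_bounded_linear) (auto intro: bounded_linear_minus bounded_linear_ident)

lemma smooth_on_diff:
  "open S \<Longrightarrow> smooth_on S f \<Longrightarrow> smooth_on S g \<Longrightarrow> smooth_on S (\<lambda>x. f x - g x)"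
  using smooth_on_add[of S f "\<lambda>x. - g x"] smooth_on_minus by auto

lemma smooth_on_sum:
  "open S \<Longrightarrow> finite I \<Longrightarrow> (\<And>i. i \<in> I \<Longrightarrow> smooth_on S (f i)) \<Longrightarrow> smooth_on S (\<lambda>x. \<Sum>i\<in>I. f i x)"
  by (simp add: smooth_on_def Ck_on_sum)

lemma smooth_on_compose:
  fixes f :: "'a::euclidean_space \<Rightarrow> 'b::euclidean_space"
  shows "open S \<Longrightarrow> open T \<Longrightarrow> f ` S \<subseteq> T \<Longrightarrow> smooth_on S f \<Longrightarrow> smooth_on T g \<Longrightarrow>
    smooth_on S (\<lambda>x. g (f x))"
  unfolding smooth_on_def using Ck_on_compose by blast

lemma smooth_on_fst: "open S \<Longrightarrow> smooth_on S f \<Longrightarrow> smooth_on S (\<lambda>x. fst (f x))"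
  by (rule smooth_on_bounded_linear[OF _ bounded_linear_fst])

lemma smooth_on_snd: "open S \<Longrightarrow> smooth_on S f \<Longrightarrow> smooth_on S (\<lambda>x. snd (f x))"
  by (rule smooth_on_bounded_linear[OF _ bounded_linear_snd])

lemma smooth_on_Pair:
  assumes "open S" "smooth_on S f" "smooth_on S g"
  shows "smooth_on S (\<lambda>x. (f x, g x))"
proof -
  have "bounded_linear (\<lambda>y. (y, 0))" "bounded_linear (\<lambda>y. (0, y))"
    by (auto intro!: bounded_linear_Pair bounded_linear_ident bounded_linear_zero)
  from smooth_on_add[OF assms(1) smooth_on_bounded_linear[OF assms(1) this(1) assms(2)]
      smooth_on_bounded_linear[OF assms(1) this(2) assms(3)]]
  show ?thesis by simp
qed

text \<open>The derivative of the reciprocal is again a product of reciprocals and constants, so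
  order \<open>k\<close> on the punctured line feeds order \<open>k + 1\<close>; composition does
  the rest.\<close>

lemma smooth_on_inverse:
  fixes f :: "'a::euclidean_space \<Rightarrow> real"
  assumes "open S" "smooth_on S f" "\<And>x. x \<in> S \<Longrightarrow> f x \<noteq> 0"
  shows "smooth_on S (\<lambda>x. inverse (f x))"
proof -
  have o: "open (- {0::real})" by auto
  have "Ck_on k (- {0::real}) inverse" for k
  proof (induction k)
    case 0
    then show ?case by (auto intro!: continuous_intros)
  next
    case (Suc k)
    show ?case
    proof (rule Ck_on_SucI[OF o])
      show "(inverse has_derivative (\<lambda>v. - (inverse x * v * inverse x))) (at x)"
        if "x \<in> - {0}" for x :: real
        using that by (intro has_derivative_inverse') simp
      show "Ck_on k (- {0::real}) (\<lambda>x. - (inverse x * v * inverse x))" for v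
        by (intro Ck_on_bounded_linear[OF o bounded_linear_minus[OF bounded_linear_ident]]
            Ck_on_bilinear[OF o bounded_bilinear_mult] Suc Ck_on_const)
    qed
  qed
  then have "smooth_on (- {0::real}) inverse" by (simp add: smooth_on_def)
  moreover have "f ` S \<subseteq> - {0}" using assms(3) by fast
  ultimately show ?thesis using smooth_on_compose[OF assms(1) o _ assms(2), of inverse] by fast
qed

lemma smooth_on_sqrt:
  fixes f :: "'a::euclidean_space \<Rightarrow> real"
  assumes "open S" "smooth_on S f" "\<And>x. x \<in> S \<Longrightarrow> f x > 0"
  shows "smooth_on S (\<lambda>x. sqrt (f x))"
proof -
  have o: "open ({0<..}::real set)" and o': "open (- {0::real})" by auto
  have i: "Ck_on k (- {0::real}) inverse" for k
    using smooth_on_inverse[OF o' smooth_on_id[OF o']] by (simp add: smooth_on_def)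
  have "Ck_on k {0::real<..} sqrt" for k
  proof (induction k)
    case 0
    then show ?case by (auto intro!: continuous_intros)
  next
    case (Suc k)
    show ?case
    proof (rule Ck_on_SucI[OF o])
      \<comment> \<open>Written through the reciprocal of \<open>sqrt\<close> itself, so that the
        induction hypothesis applies to the derivative.\<close>
      show "(sqrt has_derivative (\<lambda>v. inverse (sqrt x) * (v / 2))) (at x)"
        if "x \<in> {0<..}" for x :: real
        using that by (auto intro!: derivative_eq_intros simp: field_simps)
      show "Ck_on k {0::real<..} (\<lambda>x. inverse (sqrt x) * (v / 2))" for v
        by (rule Ck_on_bilinear[OF o bounded_bilinear_mult Ck_on_compose[OF o o' _ Suc i] Ck_on_const])
          auto
    qed
  qed
  then have "smooth_on {0::real<..} sqrt" by (simp add: smooth_on_def)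
  moreover have "f ` S \<subseteq> {0<..}" using assms(3) by fastforce
  ultimately show ?thesis using smooth_on_compose[OF assms(1) o _ assms(2), of sqrt] by fast
qed

lemma smooth_on_ln:
  fixes f :: "'a::euclidean_space \<Rightarrow> real"
  assumes "open S" "smooth_on S f" "\<And>x. x \<in> S \<Longrightarrow> f x > 0"
  shows "smooth_on S (\<lambda>x. ln (f x))"
proof (rule smooth_on_derivativeI[OF assms(1)])
  show "((\<lambda>x. ln (f x)) has_derivative (\<lambda>v. inverse (f x) * fd f x v)) (at x)" if "x \<in> S" for x
    using assms(3)[OF that] smooth_on_has_derivative[OF assms(2) that]
    by (auto intro!: derivative_eq_intros simp: field_simps)
  show "smooth_on S (\<lambda>x. inverse (f x) * fd f x v)" for v
    by (intro smooth_on_mult smooth_on_inverse smooth_on_fd assms) (use assms(3) in force)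
qed

section \<open>Second derivatives and the inverse function theorem\<close>

text \<open>The mean value theorem is used twice, along \<open>v\<close> for the increment in
  direction \<open>w\<close> and then along \<open>w\<close> for the derivative in direction
  \<open>v\<close>. The second difference is symmetric in \<open>v\<close> and \<open>w\<close>,
  which \<open>fd_symmetric_real\<close> exploits.\<close>

lemma second_difference_mvt:
  fixes f :: "'a::euclidean_space \<Rightarrow> real"
  assumes "smooth_on S f" "t > 0"
    and inS: "\<And>s r. 0 \<le> s \<Longrightarrow> s \<le> t \<Longrightarrow> 0 \<le> r \<Longrightarrow> r \<le> t \<Longrightarrow> x + s *\<^sub>R v + r *\<^sub>R w \<in> S"
  obtains s r where "0 < s" "s < t" "0 < r" "r < t"
    "f (x + t *\<^sub>R v + t *\<^sub>R w) - f (x + t *\<^sub>R v) - f (x + t *\<^sub>R w) + f x =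
      t * t * fd (\<lambda>y. fd f y v) (x + s *\<^sub>R v + r *\<^sub>R w) w"
proof -
  define g where "g s = f (x + s *\<^sub>R v + t *\<^sub>R w) - f (x + s *\<^sub>R v)" for s
  have D: "DERIV (\<lambda>s. F (a + s *\<^sub>R u)) s :> fd F (a + s *\<^sub>R u) u"
    if "smooth_on S F" "a + s *\<^sub>R u \<in> S" for F :: "'a \<Rightarrow> real" and a u s
  proof -
    note d = smooth_on_has_derivative[OF that]
    have "((\<lambda>s. F (a + s *\<^sub>R u)) has_derivative (\<lambda>h. fd F (a + s *\<^sub>R u) (h *\<^sub>R u))) (at s)"
      by (rule has_derivative_compose[of "\<lambda>s. a + s *\<^sub>R u" "\<lambda>h. h *\<^sub>R u" s UNIV F, OF _ d])
        (auto intro!: derivative_eq_intros)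
    then show ?thesis
      by (simp add: has_field_derivative_def linear_scale[OF has_derivative_linear[OF d]]
          mult.commute[of _ "fd F (a + s *\<^sub>R u) u"] mult_commute_abs)
  qed
  have "DERIV g s :> fd f (x + s *\<^sub>R v + t *\<^sub>R w) v - fd f (x + s *\<^sub>R v) v" if "0 \<le> s" "s \<le> t" for s
  proof -
    have "x + t *\<^sub>R w + s *\<^sub>R v \<in> S" "x + s *\<^sub>R v \<in> S"
      using inS[OF that, of t] inS[OF that, of 0] assms(2) by (simp_all add: add_ac)
    from D[OF assms(1) this(1)] D[OF assms(1) this(2)]
    show ?thesis unfolding g_def by (auto intro!: DERIV_diff simp: add_ac)
  qed
  from MVT2[OF assms(2) this] obtain s where s: "0 < s" "s < t"
    "g t - g 0 = t * (fd f (x + s *\<^sub>R v + t *\<^sub>R w) v - fd f (x + s *\<^sub>R v) v)"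
    by auto
  have "DERIV (\<lambda>r. fd f (x + s *\<^sub>R v + r *\<^sub>R w) v) r :> fd (\<lambda>y. fd f y v) (x + s *\<^sub>R v + r *\<^sub>R w) w"
    if "0 \<le> r" "r \<le> t" for r
    using D[OF smooth_on_fd[OF assms(1)] inS[of s r]] s that by simp
  from MVT2[OF assms(2) this] obtain r where "0 < r" "r < t"
    "fd f (x + s *\<^sub>R v + t *\<^sub>R w) v - fd f (x + s *\<^sub>R v) v =
      t * fd (\<lambda>y. fd f y v) (x + s *\<^sub>R v + r *\<^sub>R w) w"
    by auto
  with s show ?thesis by (intro that[of s r]) (auto simp: g_def)
qed

text \<open>One and the same second difference is \<open>t * t\<close> times either mixed derivative
  at points near \<open>x\<close>. By continuity each of these values is closer than half the
  supposed gap to its value at \<open>x\<close>, so they could not coincide.\<close>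

lemma fd_symmetric_real:
  fixes f :: "'a::euclidean_space \<Rightarrow> real"
  assumes S: "open S" "smooth_on S f" "x \<in> S"
  shows "fd (\<lambda>y. fd f y v) x w = fd (\<lambda>y. fd f y w) x v"
proof (rule ccontr)
  define H where "H v w y = fd (\<lambda>y. fd f y v) y w" for v w y
  assume "fd (\<lambda>y. fd f y v) x w \<noteq> fd (\<lambda>y. fd f y w) x v"
  then have e: "\<bar>H v w x - H w v x\<bar> / 2 > 0" (is "?e > 0") by (simp add: H_def)
  have "isCont (H v w) x" for v w
    using smooth_on_continuous[OF smooth_on_fd[OF smooth_on_fd[OF S(2)]]] S(1,3)
    unfolding H_def by (simp add: continuous_on_eq_continuous_at)
  then have "\<exists>d>0. \<forall>y. dist y x < d \<longrightarrow> dist (H v w y) (H v w x) < ?e" for v w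
    using e unfolding continuous_at_eps_delta by blast
  then obtain d where d: "\<And>v w. d v w > 0"
    "\<And>v w y. dist y x < d v w \<Longrightarrow> dist (H v w y) (H v w x) < ?e" by metis
  obtain d' where d': "d' > 0" "ball x d' \<subseteq> S" using S by (meson openE)
  define D where "D = min d' (min (d v w) (d w v))"
  have D: "D > 0" using d d' by (simp add: D_def)
  \<comment> \<open>Small enough to keep all intermediate points within \<open>D\<close> of
    \<open>x\<close>; the added 1 keeps the denominator positive when \<open>v\<close> and
    \<open>w\<close> vanish.\<close>
  define t where "t = D / (2 * (norm v + norm w + 1))"
  have t: "t > 0" using D by (simp add: t_def add_nonneg_pos)
  have "t * (norm v + norm w) < D"
  proof -
    have "norm v + norm w + 1 \<noteq> 0" using norm_ge_zero[of v] norm_ge_zero[of w] by linarith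
    moreover have "D / (2 * n) * n = D / 2" if "n \<noteq> 0" for n using that by simp
    ultimately have "t * (norm v + norm w + 1) = D / 2" unfolding t_def by blast
    moreover have "t * (norm v + norm w) \<le> t * (norm v + norm w + 1)"
      using t by (intro mult_left_mono) auto
    ultimately show ?thesis using D by simp
  qed
  have near: "dist (x + s *\<^sub>R v + r *\<^sub>R w) x < D" "dist (x + s *\<^sub>R w + r *\<^sub>R v) x < D"
    if "0 \<le> s" "s \<le> t" "0 \<le> r" "r \<le> t" for s r
  proof -
    have "norm (s *\<^sub>R v + r *\<^sub>R w) < D" if "0 \<le> s" "s \<le> t" "0 \<le> r" "r \<le> t" for s r
    proof -
      have "norm (s *\<^sub>R v + r *\<^sub>R w) \<le> s * norm v + r * norm w"
        using norm_triangle_ineq[of "s *\<^sub>R v" "r *\<^sub>R w"] that by simp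
      also have "\<dots> \<le> t * norm v + t * norm w"
        using that by (intro add_mono mult_right_mono) auto
      finally show ?thesis using \<open>t * (norm v + norm w) < D\<close> by (simp add: algebra_simps)
    qed
    from this[of s r] this[of r s] that show
      "dist (x + s *\<^sub>R v + r *\<^sub>R w) x < D" "dist (x + s *\<^sub>R w + r *\<^sub>R v) x < D"
      by (simp_all add: dist_norm add_ac)
  qed
  have inS: "x + s *\<^sub>R v + r *\<^sub>R w \<in> S" "x + s *\<^sub>R w + r *\<^sub>R v \<in> S"
    if "0 \<le> s" "s \<le> t" "0 \<le> r" "r \<le> t" for s r
    using near[OF that] d' by (auto simp: D_def dist_commute)
  obtain s r where sr: "0 < s" "s < t" "0 < r" "r < t"
    "f (x + t *\<^sub>R v + t *\<^sub>R w) - f (x + t *\<^sub>R v) - f (x + t *\<^sub>R w) + f x =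
      t * t * H v w (x + s *\<^sub>R v + r *\<^sub>R w)"
    unfolding H_def using second_difference_mvt[OF S(2) t inS(1)] by blast
  obtain s' r' where sr': "0 < s'" "s' < t" "0 < r'" "r' < t"
    "f (x + t *\<^sub>R w + t *\<^sub>R v) - f (x + t *\<^sub>R w) - f (x + t *\<^sub>R v) + f x =
      t * t * H w v (x + s' *\<^sub>R w + r' *\<^sub>R v)"
    unfolding H_def using second_difference_mvt[OF S(2) t inS(2)] by blast
  have "t * t * H v w (x + s *\<^sub>R v + r *\<^sub>R w) = t * t * H w v (x + s' *\<^sub>R w + r' *\<^sub>R v)"
    using sr(5) sr'(5) by (simp add: algebra_simps)
  then have eq: "H v w (x + s *\<^sub>R v + r *\<^sub>R w) = H w v (x + s' *\<^sub>R w + r' *\<^sub>R v)"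
    using t by simp
  have "dist (H v w (x + s *\<^sub>R v + r *\<^sub>R w)) (H v w x) < ?e"
    using d(2) near(1)[of s r] sr by (simp add: D_def)
  moreover have "dist (H w v (x + s' *\<^sub>R w + r' *\<^sub>R v)) (H w v x) < ?e"
    using d(2) near(2)[of s' r'] sr' by (simp add: D_def)
  ultimately show False unfolding eq by (simp add: dist_real_def abs_if split: if_splits)
qed

lemma fd_inner_left:
  "f differentiable at x \<Longrightarrow> fd (\<lambda>y. f y \<bullet> b) x v = fd f x v \<bullet> b"
  by (rule fd_eq) (auto simp: frechet_derivative_works intro!: derivative_eq_intros)

lemma smooth_on_differentiable: "smooth_on S f \<Longrightarrow> x \<in> S \<Longrightarrow> f differentiable at x"
  using smooth_on_has_derivative differentiable_def by blast

lemma fd_symmetric: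
  fixes f :: "'a::euclidean_space \<Rightarrow> 'b::euclidean_space"
  assumes S: "open S" "smooth_on S f" "x \<in> S"
  shows "fd (\<lambda>y. fd f y v) x w = fd (\<lambda>y. fd f y w) x v"
proof (rule euclidean_eqI)
  fix b :: 'b
  have "fd (\<lambda>y. fd f y v) x w \<bullet> b = fd (\<lambda>y. fd (\<lambda>z. f z \<bullet> b) y v) x w" for v w
  proof -
    have "fd (\<lambda>y. fd f y v) x w \<bullet> b = fd (\<lambda>y. fd f y v \<bullet> b) x w"
      by (intro fd_inner_left[symmetric] smooth_on_differentiable[OF smooth_on_fd[OF S(2)] S(3)])
    also have "\<dots> = fd (\<lambda>y. fd (\<lambda>z. f z \<bullet> b) y v) x w"
      by (intro fun_cong[OF fd_cong_open[OF S(1,3)]] fd_inner_left[symmetric]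
          smooth_on_differentiable[OF S(2)])
    finally show ?thesis .
  qed
  moreover have "smooth_on S (\<lambda>z. f z \<bullet> b)"
    by (intro smooth_on_inner S smooth_on_const)
  ultimately show "fd (\<lambda>y. fd f y v) x w \<bullet> b = fd (\<lambda>y. fd f y w) x v \<bullet> b"
    using fd_symmetric_real[OF S(1) _ S(3)] by simp
qed

text \<open>Because \<open>g x = 0\<close>, continuity of \<open>c\<close> suffices for
  differentiating the product. This matters in \<open>Ck_on_inverse_family\<close>, where the
  inverse is known only to be continuous at the moment it has to be differentiated.\<close>

lemma has_derivative_scaleR_zero:
  fixes g :: "'a::real_normed_vector \<Rightarrow> real"
  assumes g: "(g has_derivative g') (at x)" "g x = 0" and c: "isCont c x"
  shows "((\<lambda>y. g y *\<^sub>R c y) has_derivative (\<lambda>h. g' h *\<^sub>R c x)) (at x)"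
  unfolding has_derivative_within_alt
proof (intro conjI allI impI)
  have bl: "bounded_linear g'" using g(1) by (rule has_derivative_bounded_linear)
  then show "bounded_linear (\<lambda>h. g' h *\<^sub>R c x)" by (rule bounded_linear_scaleR_const)
  fix e :: real
  assume e: "e > 0"
  obtain B where B: "B > 0" "\<And>h. norm (g' h) \<le> norm h * B"
    using bounded_linear.pos_bounded[OF bl] by blast
  \<comment> \<open>The cap 1 bounds \<open>g y\<close> by \<open>B + 1\<close> times the distance;
    the other bound keeps the error of \<open>g\<close>, multiplied by the norm of
    \<open>c x\<close>, within half of \<open>e\<close>.\<close>
  define e1 where "e1 = min 1 (e / (2 * (norm (c x) + 1)))"
  have e1: "0 < e1" "e1 \<le> 1" using e by (auto simp: e1_def add_nonneg_pos)
  have e1c: "e1 * norm (c x) \<le> e / 2"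
  proof -
    have "e1 * norm (c x) \<le> e / (2 * (norm (c x) + 1)) * (norm (c x) + 1)"
      using e1 e by (intro mult_mono) (auto simp: e1_def)
    also have "\<dots> = e / 2"
    proof -
      have "norm (c x) + 1 \<noteq> 0" using norm_ge_zero[of "c x"] by linarith
      moreover have "e / (2 * n) * n = e / 2" if "n \<noteq> 0" for n :: real using that by simp
      ultimately show ?thesis by blast
    qed
    finally show ?thesis .
  qed
  obtain d1 where d1: "d1 > 0"
    "\<And>y. norm (y - x) < d1 \<Longrightarrow> norm (g y - g' (y - x)) \<le> e1 * norm (y - x)"
    using g e1(1) unfolding has_derivative_within_alt by auto
  have "e / (2 * (B + 1)) > 0" using e B by simp
  then obtain d2 where d2: "d2 > 0"
    "\<And>y. norm (y - x) < d2 \<Longrightarrow> norm (c y - c x) < e / (2 * (B + 1))"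
    using c unfolding continuous_at_eps_delta dist_norm by blast
  have "norm (g y *\<^sub>R c y - g x *\<^sub>R c x - g' (y - x) *\<^sub>R c x) \<le> e * norm (y - x)"
    if y: "norm (y - x) < min d1 d2" for y
  proof -
    have "norm (g y) \<le> norm (g y - g' (y - x)) + norm (g' (y - x))"
      using norm_triangle_ineq[of "g y - g' (y - x)" "g' (y - x)"] by simp
    also have "\<dots> \<le> 1 * norm (y - x) + norm (y - x) * B"
      using d1(2)[of y] y B(2)[of "y - x"] mult_right_mono[OF e1(2) norm_ge_zero[of "y - x"]] by simp
    finally have gy: "norm (g y) \<le> (B + 1) * norm (y - x)" by (simp add: algebra_simps)
    have "g y *\<^sub>R c y - g x *\<^sub>R c x - g' (y - x) *\<^sub>R c x =
        g y *\<^sub>R (c y - c x) + (g y - g' (y - x)) *\<^sub>R c x"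
      using g(2) by (simp add: algebra_simps)
    also have "norm \<dots> \<le> norm (g y) * norm (c y - c x) + norm (g y - g' (y - x)) * norm (c x)"
      using norm_triangle_ineq[of "g y *\<^sub>R (c y - c x)" "(g y - g' (y - x)) *\<^sub>R c x"] by simp
    also have "\<dots> \<le> ((B + 1) * norm (y - x)) * (e / (2 * (B + 1))) + (e1 * norm (y - x)) * norm (c x)"
      using gy d2(2)[of y] d1(2)[of y] y B by (intro add_mono mult_mono) auto
    also have "\<dots> = e / 2 * norm (y - x) + (e1 * norm (c x)) * norm (y - x)"
      using B by (simp add: field_simps)
    also have "\<dots> \<le> e / 2 * norm (y - x) + e / 2 * norm (y - x)"
      using e1c by (intro add_mono mult_right_mono) auto
    finally show ?thesis by (simp add: field_simps)
  qed
  then show "\<exists>d>0. \<forall>y\<in>UNIV. norm (y - x) < d \<longrightarrow>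
      norm (g y *\<^sub>R c y - g x *\<^sub>R c x - g' (y - x) *\<^sub>R c x) \<le> e * norm (y - x)"
    using d1(1) d2(1) by (intro exI[of _ "min d1 d2"]) auto
qed

lemma linear_right_inverse:
  assumes "linear M" "\<And>v. M (J v) = v" "\<And>v. J (M v) = v"
  shows "linear J"
proof (rule linearI)
  show "J (a + b) = J a + J b" for a b
  proof -
    have "J (a + b) = J (M (J a + J b))" by (simp add: linear_add[OF assms(1)] assms(2))
    then show ?thesis by (simp add: assms(3))
  qed
  show "J (r *\<^sub>R b) = r *\<^sub>R J b" for r b
  proof -
    have "J (r *\<^sub>R b) = J (M (r *\<^sub>R J b))" by (simp add: linear_scale[OF assms(1)] assms(2))
    then show ?thesis by (simp add: assms(3))
  qed
qed

text \<open>A perturbation argument: near \<open>x0\<close> the difference of \<open>M x\<close> and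
  \<open>M x0\<close> is small against the inverse at \<open>x0\<close>. This first bounds
  \<open>J x v\<close> uniformly; then, with \<open>y = J x v\<close>, the identity
  \<open>y - J x0 v = J x0 (M x0 y - M x y)\<close> gives convergence.\<close>

lemma continuous_on_inverse_family:
  fixes M J :: "'a::euclidean_space \<Rightarrow> 'b::euclidean_space \<Rightarrow> 'b"
  assumes S: "open S" and lin: "\<And>x. x \<in> S \<Longrightarrow> linear (M x)"
    and MJ: "\<And>x v. x \<in> S \<Longrightarrow> M x (J x v) = v" and JM: "\<And>x v. x \<in> S \<Longrightarrow> J x (M x v) = v"
    and cont: "\<And>v. continuous_on S (\<lambda>x. M x v)"
  shows "continuous_on S (\<lambda>x. J x v)"
proof -
  have "(\<lambda>x. J x v) \<midarrow>x0\<rightarrow> J x0 v" if x0: "x0 \<in> S" for x0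
  proof -
    have linJ: "linear (J x0)" using linear_right_inverse[OF lin[OF x0] MJ[OF x0] JM[OF x0]] .
    obtain K where K: "K > 0" "\<And>u. norm (J x0 u) \<le> K * norm u"
      using linear_bounded_pos[OF linJ] by blast
    \<comment> \<open>Bounds the operator norm of the difference, and tends to 0 because continuity
      holds on each of the finitely many basis vectors.\<close>
    define s where "s x = (\<Sum>b\<in>Basis. norm (M x b - M x0 b))" for x
    have s: "s \<midarrow>x0\<rightarrow> 0"
    proof -
      have "(\<lambda>x. M x b) \<midarrow>x0\<rightarrow> M x0 b" for b
        using cont[of b] S x0 continuous_on_eq_continuous_at[OF S] isCont_def by blast
      then have "(\<lambda>x. norm (M x b - M x0 b)) \<midarrow>x0\<rightarrow> 0" for b
        using LIM_zero_iff tendsto_norm_zero by blast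
      then have "(\<lambda>x. \<Sum>b\<in>(Basis::'b set). norm (M x b - M x0 b)) \<midarrow>x0\<rightarrow> (\<Sum>b\<in>(Basis::'b set). 0)"
        by (intro tendsto_sum)
      then show ?thesis by (simp add: s_def[abs_def])
    qed
    have sb: "norm (M x y - M x0 y) \<le> s x * norm y" if "x \<in> S" for x y
    proof -
      have "M x y - M x0 y = (\<Sum>b\<in>Basis. (y \<bullet> b) *\<^sub>R (M x b - M x0 b))"
        by (simp add: linear_basis_expansion[OF lin[OF that], of y]
            linear_basis_expansion[OF lin[OF x0], of y] scaleR_diff_right sum_subtractf)
      also have "norm \<dots> \<le> (\<Sum>b\<in>Basis. norm y * norm (M x b - M x0 b))"
        by (intro order_trans[OF norm_sum] sum_mono) (simp add: mult_right_mono Basis_le_norm)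
      finally show ?thesis by (simp add: s_def sum_distrib_left mult.commute)
    qed
    have "\<forall>\<^sub>F x in at x0. x \<in> S"
      using S x0 by (rule eventually_at_in_open')
    \<comment> \<open>Makes \<open>K * s x\<close> at most 1/2, so that the term with the norm of
      \<open>y\<close> can be absorbed on the left; this is the origin of the factor 2 in the
      bound.\<close>
    moreover have "\<forall>\<^sub>F x in at x0. s x < 1 / (2 * K)"
      using order_tendstoD(2)[OF s, of "1 / (2 * K)"] K by simp
    ultimately have "\<forall>\<^sub>F x in at x0. norm (J x v - J x0 v) \<le> 2 * K * K * norm v * s x"
    proof eventually_elim
      case (elim x)
      define y where "y = J x v"
      have y: "M x y = v" "J x0 (M x0 y) = y" using elim MJ JM x0 by (auto simp: y_def)
      have s0: "s x \<ge> 0" by (auto simp: s_def intro: sum_nonneg)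
      have "norm (M x0 y) \<le> norm v + s x * norm y"
        using norm_triangle_ineq4[of "M x y" "M x y - M x0 y"] sb[OF elim(1), of y] y(1) by simp
      then have "norm y \<le> K * (norm v + s x * norm y)"
        using K(2)[of "M x0 y"] y(2) K(1) by (smt (verit) mult_left_mono)
      also have "\<dots> = K * norm v + (K * s x) * norm y" by (simp add: algebra_simps)
      also have "\<dots> \<le> K * norm v + 1 / 2 * norm y"
        using elim(2) K(1) by (intro add_left_mono mult_right_mono) (auto simp: field_simps)
      finally have yb: "norm y \<le> 2 * K * norm v" by simp
      have "y - J x0 v = J x0 (M x0 y - M x y)"
        using y by (simp add: linear_diff[OF linJ])
      then have "norm (y - J x0 v) \<le> K * norm (M x0 y - M x y)" using K(2) by metis
      also have "\<dots> \<le> K * (s x * norm y)"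
        using sb[OF elim(1), of y] K(1) by (simp add: norm_minus_commute)
      also have "\<dots> \<le> K * (s x * (2 * K * norm v))"
        using yb K(1) s0 by (intro mult_left_mono) auto
      finally show ?case by (simp add: y_def algebra_simps)
    qed
    moreover have "((\<lambda>x. 2 * K * K * norm v * s x) \<longlongrightarrow> 0) (at x0)"
      using tendsto_mult_right_zero[OF s] by simp
    ultimately have "(\<lambda>x. J x v - J x0 v) \<midarrow>x0\<rightarrow> 0" by (rule Lim_null_comparison)
    then show ?thesis by (simp add: LIM_zero_iff)
  qed
  then show ?thesis using continuous_on_eq_continuous_at[OF S] isCont_def by blast
qed

text \<open>The derivative of the inverse family is minus \<open>J\<close> after the derivative of
  \<open>M\<close> after \<open>J\<close>. It uses \<open>J\<close> itself and one derivative of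
  \<open>M\<close>, so order \<open>k\<close> of \<open>J\<close> and order \<open>k + 1\<close> of
  \<open>M\<close> give order \<open>k + 1\<close> of \<open>J\<close>. The double sum
  \<open>?D\<close> is this formula with fixed directions only.\<close>

lemma Ck_on_inverse_family:
  fixes M J :: "'a::euclidean_space \<Rightarrow> 'b::euclidean_space \<Rightarrow> 'b"
  assumes S: "open S" and lin: "\<And>x. x \<in> S \<Longrightarrow> linear (M x)"
    and MJ: "\<And>x v. x \<in> S \<Longrightarrow> M x (J x v) = v" and JM: "\<And>x v. x \<in> S \<Longrightarrow> J x (M x v) = v"
  shows "(\<And>v. Ck_on k S (\<lambda>x. M x v)) \<Longrightarrow> Ck_on k S (\<lambda>x. J x v)"
proof (induction k arbitrary: v)
  case 0
  then show ?case using continuous_on_inverse_family[OF S lin MJ JM] by simp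
next
  case (Suc k)
  have IH: "Ck_on k S (\<lambda>x. J x v)" for v
    by (rule Suc.IH) (use Ck_on_Suc_imp Suc.prems in blast)
  let ?D = "\<lambda>x h. - (\<Sum>b\<in>Basis. \<Sum>c\<in>Basis. ((J x v \<bullet> c) * (fd (\<lambda>y. M y c) x h \<bullet> b)) *\<^sub>R J x b)"
  show ?case
  proof (rule Ck_on_SucI[OF S])
    fix x
    assume x: "x \<in> S"
    define w where "w = J x v"
    have contJ: "isCont (\<lambda>y. J y u) x" for u
    proof -
      have "Ck_on 0 S (\<lambda>x. M x v)" for v
      proof -
        have "continuous_on S (\<lambda>x. M x v)"
          by (rule continuous_at_imp_continuous_on) (use Suc.prems in \<open>auto intro: differentiable_imp_continuous_within\<close>)
        then show ?thesis by simp
      qed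
      then have "continuous_on S (\<lambda>y. J y u)"
        using continuous_on_inverse_family[of S M J u, OF S lin MJ JM] by simp
      then show ?thesis using x S by (simp add: continuous_on_eq_continuous_at)
    qed
    \<comment> \<open>The identity \<open>J y (M y w - M x w) = w - J y v\<close> in coordinates.
      Its coefficients vanish at \<open>y = x\<close>, which is the situation of
      \<open>has_derivative_scaleR_zero\<close>.\<close>
    have eq: "J y v = w - (\<Sum>b\<in>Basis. \<Sum>c\<in>Basis. ((w \<bullet> c) * ((M y c - M x c) \<bullet> b)) *\<^sub>R J y b)"
      if y: "y \<in> S" for y
    proof -
      note linJ = linear_right_inverse[OF lin[OF y] MJ[OF y] JM[OF y]]
      have "M y w - M x w = (\<Sum>c\<in>Basis. (w \<bullet> c) *\<^sub>R (M y c - M x c))"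
        by (simp add: linear_basis_expansion[OF lin[OF y], of w]
            linear_basis_expansion[OF lin[OF x], of w] scaleR_diff_right sum_subtractf)
      then have "J y (M y w - M x w) =
          (\<Sum>b\<in>Basis. \<Sum>c\<in>Basis. ((w \<bullet> c) * ((M y c - M x c) \<bullet> b)) *\<^sub>R J y b)"
        by (subst linear_basis_expansion[OF linJ]) (simp add: inner_sum_left scaleR_sum_left)
      moreover have "J y (M y w - M x w) = w - J y v"
        using JM[OF y, of w] MJ[OF x, of v] by (simp add: linear_diff[OF linJ] w_def)
      ultimately show ?thesis by (simp add: algebra_simps)
    qed
    have "((\<lambda>y. w - (\<Sum>b\<in>Basis. \<Sum>c\<in>Basis. ((w \<bullet> c) * ((M y c - M x c) \<bullet> b)) *\<^sub>R J y b))
        has_derivative (\<lambda>h. 0 - (\<Sum>b\<in>Basis. \<Sum>c\<in>Basis. ((w \<bullet> c) * (fd (\<lambda>y. M y c) x h \<bullet> b)) *\<^sub>R J x b)))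
        (at x)"
    proof (intro has_derivative_diff has_derivative_const has_derivative_sum
        has_derivative_scaleR_zero contJ)
      show "((\<lambda>y. (w \<bullet> c) * ((M y c - M x c) \<bullet> b)) has_derivative
          (\<lambda>h. (w \<bullet> c) * (fd (\<lambda>y. M y c) x h \<bullet> b))) (at x)" for b c
        using Ck_on_has_derivative[OF Suc.prems x, of c]
        by (auto intro!: derivative_eq_intros)
    qed simp
    then have "((\<lambda>y. w - (\<Sum>b\<in>Basis. \<Sum>c\<in>Basis. ((w \<bullet> c) * ((M y c - M x c) \<bullet> b)) *\<^sub>R J y b))
        has_derivative ?D x) (at x)"
      by (simp add: w_def)
    then show "((\<lambda>y. J y v) has_derivative ?D x) (at x)"
      by (rule has_derivative_transform_within_open[OF _ S x]) (use eq in simp)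
  next
    show "Ck_on k S (\<lambda>x. ?D x h)" for h
    proof (intro Ck_on_bounded_linear[OF S bounded_linear_minus[OF bounded_linear_ident]] Ck_on_sum
        Ck_on_bilinear[OF S bounded_bilinear_scaleR] Ck_on_bilinear[OF S bounded_bilinear_mult] S IH)
      show "Ck_on k S (\<lambda>x. J x v \<bullet> c)" for c
        by (intro Ck_on_bounded_linear[OF S bounded_linear_inner_left] IH)
      show "Ck_on k S (\<lambda>x. fd (\<lambda>y. M y c) x h \<bullet> b)" for b c
        by (intro Ck_on_bounded_linear[OF S bounded_linear_inner_left]) (use Suc.prems in simp)
    qed simp_all
  qed
qed

text \<open>Continuous differentiability yields the local inverse and identifies \<open>g' y\<close>
  as the inverse of \<open>fd f (g y)\<close>. Smoothness is a bootstrap: if \<open>g\<close> has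
  order \<open>k\<close>, so has \<open>fd f (g y)\<close> in every fixed direction, hence so has
  its inverse \<open>g' y\<close>, and \<open>g\<close> has order \<open>k + 1\<close>.\<close>

theorem smooth_inverse_function:
  fixes f :: "'a::euclidean_space \<Rightarrow> 'a"
  assumes U: "open U" "smooth_on U f" "x0 \<in> U" "inj (fd f x0)"
  obtains U' V g where "open U'" "U' \<subseteq> U" "x0 \<in> U'" "open V" "homeomorphism U' V f g" "smooth_on V g"
proof -
  have bl: "bounded_linear (fd f x)" if "x \<in> U" for x
    using smooth_on_has_derivative[OF U(2) that] has_derivative_bounded_linear by blast
  define f' where "f' x = Blinfun (fd f x)" for x
  have f': "blinfun_apply (f' x) = fd f x" if "x \<in> U" for x
    using bl[OF that] by (simp add: f'_def bounded_linear_Blinfun_apply)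
  have contf': "continuous_on U f'"
  proof (rule continuous_on_blinfun_componentwise)
    show "continuous_on U (\<lambda>x. blinfun_apply (f' x) i)" for i
      using smooth_on_continuous[OF smooth_on_fd[OF U(2)], of i] f'
      by (simp cong: continuous_on_cong)
  qed
  obtain G where G: "linear G" "G \<circ> fd f x0 = id"
    using linear_injective_left_inverse[OF smooth_on_linear_fd[OF U(2,3)] U(4)] by blast
  have "bounded_linear G" using G(1) by (simp add: linear_conv_bounded_linear)
  then have "Blinfun G o\<^sub>L f' x0 = id_blinfun"
    using G(2) f'[OF U(3)]
    by (intro blinfun_eqI) (simp add: bounded_linear_Blinfun_apply fun_eq_iff)
  moreover have "(f has_derivative blinfun_apply (f' x)) (at x)" if "x \<in> U" for x
    using smooth_on_has_derivative[OF U(2) that] f'[OF that] by simp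
  ultimately obtain U' V g g' where *: "open U'" "U' \<subseteq> U" "x0 \<in> U'" "open V" "homeomorphism U' V f g"
    "\<And>y. y \<in> V \<Longrightarrow> (g has_derivative (g' y)) (at y)"
    "\<And>y. y \<in> V \<Longrightarrow> g' y = inv (blinfun_apply (f' (g y)))"
    "\<And>y. y \<in> V \<Longrightarrow> bij (blinfun_apply (f' (g y)))"
    using inverse_function_theorem[OF U(1) _ contf' U(3)] by metis
  have gV: "g ` V \<subseteq> U" "g ` V \<subseteq> U'" using * homeomorphism_image2 by blast+
  have "Ck_on k V g" for k
  proof (induction k)
    case 0
    then show ?case using homeomorphism_cont2[OF *(5)] by simp
  next
    case (Suc k)
    show ?case
    proof (rule Ck_on_SucI[OF *(4,6)])
      fix v
      show "Ck_on k V (\<lambda>y. g' y v)"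
      proof (rule Ck_on_inverse_family[OF *(4)])
        fix y u
        assume y: "y \<in> V"
        then have gy: "g y \<in> U" using gV by blast
        show "linear (fd f (g y))" using smooth_on_linear_fd[OF U(2) gy] .
        show "fd f (g y) (g' y u) = u" "g' y (fd f (g y) u) = u"
          using *(7,8)[OF y] f'[OF gy] by (simp_all add: bij_is_surj surj_f_inv_f bij_is_inj inv_f_f)
      next
        show "Ck_on k V (\<lambda>y. fd f (g y) u)" for u
          using Ck_on_compose[OF *(4) U(1) gV(1) Suc, of "\<lambda>x. fd f x u"] smooth_on_fd[OF U(2)]
          by (simp add: smooth_on_def)
      qed
    qed
  qed
  then show ?thesis using that * by (simp add: smooth_on_def)
qed

section \<open>Charts of the 1-jet space and its symplectization\<close>

lemma fd_bounded_linear: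
  "bounded_linear L \<Longrightarrow> f differentiable at x \<Longrightarrow> fd (\<lambda>y. L (f y)) x v = L (fd f x v)"
  by (rule fd_eq[OF bounded_linear.has_derivative]) (simp_all add: frechet_derivative_works)

lemma bounded_linear_jet_components:
  "bounded_linear (\<lambda>y :: real \<times> (('e::euclidean_space \<times> 'e) \<times> real). fst (fst (snd y)))"
  "bounded_linear (\<lambda>y :: real \<times> (('e::euclidean_space \<times> 'e) \<times> real). snd (snd y))"
  by (intro bounded_linear_fst_comp bounded_linear_snd_comp bounded_linear_ident)+

lemma fd_compose:
  assumes "f differentiable at x" "g differentiable at (f x)"
  shows "fd (\<lambda>y. g (f y)) x v = fd g (f x) (fd f x v)"
  by (rule fd_eq[OF has_derivative_compose[of f "fd f x" x UNIV g "fd g (f x)"]])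
    (use assms in \<open>simp_all add: frechet_derivative_works\<close>)

lemma symplectization_primitive_eq:
  "symplectization_primitive x y =
    exp (fst x) * (snd (snd y) - snd (fst (snd x)) \<bullet> fst (fst (snd y)))"
  by (simp add: symplectization_primitive_def contact_form_def canonical_form_def split_beta)

text \<open>Naturality of the exterior derivative; the second derivatives of \<open>F\<close> cancel by symmetry.\<close>

lemma symplectization_form_pullback:
  fixes F :: "'a::euclidean_space \<Rightarrow> real \<times> (('e::euclidean_space \<times> 'e) \<times> real)"
  assumes N: "open N" "smooth_on N F" "u \<in> N"
  shows "symplectization_form (F u) (fd F u v) (fd F u w) =
    fd (\<lambda>x. symplectization_primitive (F x) (fd F x w)) u v -
    fd (\<lambda>x. symplectization_primitive (F x) (fd F x v)) u w"
proof -
  have *: "fd (\<lambda>x. symplectization_primitive (F x) (fd F x w)) u v =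
      exp (fst (F u)) * fst (fd F u v) *
        (snd (snd (fd F u w)) - snd (fst (snd (F u))) \<bullet> fst (fst (snd (fd F u w)))) +
      exp (fst (F u)) * (snd (snd (fd (\<lambda>x. fd F x w) u v)) -
        (snd (fst (snd (fd F u v))) \<bullet> fst (fst (snd (fd F u w))) +
         snd (fst (snd (F u))) \<bullet> fst (fst (snd (fd (\<lambda>x. fd F x w) u v)))))" for v w
    unfolding symplectization_primitive_eq
    using smooth_on_has_derivative[OF N(2,3)] smooth_on_has_derivative[OF smooth_on_fd[OF N(2)] N(3), of w]
    by (intro fd_eq) (auto intro!: derivative_eq_intros simp: algebra_simps)
  show ?thesis
    unfolding * fd_symmetric[OF N, of w v]
    by (cases "F u"; cases "fd F u v"; cases "fd F u w")
      (auto simp: symplectization_form_eq algebra_simps inner_commute)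
qed

text \<open>In the chart \<open>d\<close> this is the transposed Jacobian of the change from
  \<open>d\<close> to \<open>c\<close>, applied to \<open>p\<close> and read off on the basis.
  Covectors are families over all charts, so prescribing one component means producing the others;
  the default 0 is the one \<open>cotangent_space\<close> demands.\<close>

definition covector :: "('m, 'e::euclidean_space) chart set \<Rightarrow> ('m, 'e) chart \<Rightarrow> 'm \<Rightarrow> 'e \<Rightarrow>
    (('m, 'e) chart \<Rightarrow> 'e)" where
  "covector A c x p = (\<lambda>d. if d \<in> A \<and> x \<in> fst d
     then \<Sum>b\<in>Basis. (p \<bullet> fd (transition d c) (snd d x) b) *\<^sub>R b else 0)"

text \<open>Serves as the inverse of the coordinate map of \<open>jet_chart A c\<close>;
  \<open>inv_into\<close> returns the intended point only for \<open>q\<close> in the image of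
  \<open>c\<close>.\<close>

definition jet_point :: "('m, 'e::euclidean_space) chart set \<Rightarrow> ('m, 'e) chart \<Rightarrow>
    ('e \<times> 'e) \<times> real \<Rightarrow> ('m, 'e) jet" where
  "jet_point A c = (\<lambda>((q, p), z).
     let x = inv_into (fst c) (snd c) q in ((x, covector A c x p), z))"

section \<open>Transition maps and covectors\<close>

lemma smooth_manifold_chart: "smooth_manifold A \<Longrightarrow> c \<in> A \<Longrightarrow> is_chart c"
  by (simp add: smooth_manifold_def)

lemma smooth_manifold_transition:
  assumes "smooth_manifold A" "c \<in> A" "d \<in> A"
  shows "open (snd c ` (fst c \<inter> fst d))" "smooth_on (snd c ` (fst c \<inter> fst d)) (transition c d)"
  using assms by (auto simp: smooth_manifold_def smooth_transition_def)

lemma chart_inv: "is_chart c \<Longrightarrow> x \<in> fst c \<Longrightarrow> inv_into (fst c) (snd c) (snd c x) = x"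
  by (simp add: is_chart_def)

lemma transition_apply: "is_chart c \<Longrightarrow> x \<in> fst c \<Longrightarrow> transition c d (snd c x) = snd d x"
  by (simp add: transition_def chart_inv)

lemma transition_differentiable:
  assumes "smooth_manifold A" "c \<in> A" "d \<in> A" "x \<in> fst c" "x \<in> fst d"
  shows "transition c d differentiable at (snd c x)"
  using smooth_on_differentiable[OF smooth_manifold_transition(2)[OF assms(1-3)]] assms(4,5) by blast

lemma transition_cocycle:
  assumes M: "smooth_manifold A" "c \<in> A" "d \<in> A" "e \<in> A" and x: "x \<in> fst c" "x \<in> fst d" "x \<in> fst e"
  shows "fd (transition c e) (snd c x) v = fd (transition d e) (snd d x) (fd (transition c d) (snd c x) v)"
proof -
  let ?S = "snd c ` (fst c \<inter> fst d) \<inter> snd c ` (fst c \<inter> fst e)"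
  have c: "is_chart c" and d: "is_chart d" using smooth_manifold_chart M by blast+
  have "open ?S" using smooth_manifold_transition(1)[OF M(1,2)] M(3,4) by blast
  moreover have "snd c x \<in> ?S" using x by blast
  moreover have "transition c e y = transition d e (transition c d y)" if "y \<in> ?S" for y
  proof -
    from that obtain x' where "x' \<in> fst c" "x' \<in> fst d" "y = snd c x'" by blast
    then show ?thesis using c d by (simp add: transition_apply)
  qed
  ultimately have "fd (transition c e) (snd c x) v = fd (\<lambda>y. transition d e (transition c d y)) (snd c x) v"
    by (intro fun_cong[OF fd_cong_open])
  also have "\<dots> = fd (transition d e) (snd d x) (fd (transition c d) (snd c x) v)"
    using transition_differentiable[OF M(1,2,3) x(1,2)] transition_differentiable[OF M(1,3,4) x(2,3)]
    by (simp add: fd_compose transition_apply[OF c x(1)])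
  finally show ?thesis .
qed

lemma fd_transition_self:
  assumes "smooth_manifold A" "c \<in> A" "x \<in> fst c"
  shows "fd (transition c c) (snd c x) v = v"
proof -
  have c: "is_chart c" using smooth_manifold_chart assms by blast
  have "fd (transition c c) (snd c x) v = fd (\<lambda>y. y) (snd c x) v"
  proof (rule fun_cong[OF fd_cong_open])
    show "open (snd c ` fst c)" using c by (simp add: is_chart_def)
    show "transition c c y = y" if "y \<in> snd c ` fst c" for y using that transition_apply[OF c, of _ c] by auto
  qed (use assms in simp)
  then show ?thesis by (simp add: fd_eq[OF has_derivative_ident])
qed

lemma covector_inner:
  assumes "smooth_manifold A" "c \<in> A" "d \<in> A" "x \<in> fst c" "x \<in> fst d"
  shows "covector A c x p d \<bullet> v = p \<bullet> fd (transition d c) (snd d x) v"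
proof -
  have lin: "linear (fd (transition d c) (snd d x))"
    using transition_differentiable[OF assms(1,3,2,5,4)] linear_frechet_derivative by blast
  have "covector A c x p d \<bullet> v = (\<Sum>b\<in>Basis. (p \<bullet> fd (transition d c) (snd d x) b) * (b \<bullet> v))"
    using assms by (simp add: covector_def inner_sum_left)
  also have "\<dots> = p \<bullet> fd (transition d c) (snd d x) v"
    by (subst linear_basis_expansion[OF lin, of v])
      (simp add: inner_sum_right inner_commute mult.commute)
  finally show ?thesis .
qed

lemma covector_base:
  assumes "smooth_manifold A" "c \<in> A" "x \<in> fst c"
  shows "covector A c x p c = p"
  by (rule vector_eq_rdot[THEN iffD1])
    (simp add: covector_inner[OF assms(1,2,2,3,3)] fd_transition_self[OF assms])

lemma covector_in_cotangent_space:
  assumes "smooth_manifold A" "c \<in> A" "x \<in> fst c"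
  shows "covector A c x p \<in> cotangent_space A x"
  unfolding cotangent_space_def
proof (intro CollectI conjI ballI impI allI)
  fix d e v
  assume "d \<in> A" "e \<in> A" "x \<in> fst d" "x \<in> fst e"
  then show "covector A c x p d \<bullet> v = covector A c x p e \<bullet> fd (transition d e) (snd d x) v"
    using assms by (simp add: covector_inner transition_cocycle[of A d e c])
qed (auto simp: covector_def)

lemma covector_unique:
  assumes "smooth_manifold A" "c \<in> A" "x \<in> fst c" "\<xi> \<in> cotangent_space A x"
  shows "covector A c x (\<xi> c) = \<xi>"
proof
  fix d
  show "covector A c x (\<xi> c) d = \<xi> d"
  proof (cases "d \<in> A \<and> x \<in> fst d")
    case True
    then have "\<xi> d \<bullet> v = \<xi> c \<bullet> fd (transition d c) (snd d x) v" for v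
      using assms(2-4) unfolding cotangent_space_def by blast
    with True show ?thesis
      by (intro vector_eq_rdot[THEN iffD1]) (simp add: covector_inner[OF assms(1,2)] assms(3))
  next
    case False
    then have "\<xi> d = 0" using assms(4) unfolding cotangent_space_def by blast
    with False show ?thesis unfolding covector_def by argo
  qed
qed

definition jet_chart ::
  "('m, 'e::euclidean_space) chart set \<Rightarrow> ('m, 'e) chart \<Rightarrow> (('m, 'e) jet, ('e \<times> 'e) \<times> real) chart" where
  "jet_chart A c = (Sigma (fst c) (cotangent_space A) \<times> UNIV, \<lambda>((x, \<xi>), z). ((snd c x, \<xi> c), z))"

lemma jet_atlas_eq:
  fixes A :: "('m, 'e::euclidean_space) chart set"
  shows "jet_atlas A = jet_chart A ` A"
proof -
  have "cotangent_atlas A = (\<lambda>c. (Sigma (fst c) (cotangent_space A), \<lambda>(x, \<xi>). (snd c x, \<xi> c))) ` A"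
    unfolding cotangent_atlas_def by blast
  moreover have "prod_atlas B {(UNIV, id :: real \<Rightarrow> real)} = (\<lambda>c. (fst c \<times> UNIV, map_prod (snd c) id)) ` B"
    for B :: "(('m, 'e) cotangent, 'e \<times> 'e) chart set"
    unfolding prod_atlas_def by (auto simp: image_iff simp del: split_paired_Ex intro: bexI)
  moreover have "map_prod (\<lambda>(x, \<xi>). (snd c x, \<xi> c :: 'e)) id = (\<lambda>((x, \<xi>), z :: real). ((snd c x, \<xi> c), z))"
    for c :: "('m, 'e) chart"
    by (auto simp: fun_eq_iff)
  ultimately show ?thesis unfolding jet_atlas_def jet_chart_def by (simp add: image_image)
qed

lemma neg_symplectization_atlas_eq:
  fixes A :: "('m, 'e::euclidean_space) chart set"
  shows "neg_symplectization_atlas A =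
    (\<lambda>c. ({..<0} \<times> fst (jet_chart A c), \<lambda>(s, y). (s, snd (jet_chart A c) y))) ` A"
proof -
  have "prod_atlas {({..<0}, id :: real \<Rightarrow> real)} B = (\<lambda>c. ({..<0} \<times> fst c, map_prod id (snd c))) ` B"
    for B :: "(('m, 'e) jet, ('e \<times> 'e) \<times> real) chart set"
    unfolding prod_atlas_def by (auto simp: image_iff simp del: split_paired_Ex intro: bexI)
  moreover have "map_prod id (snd (jet_chart A c)) = (\<lambda>(s :: real, y). (s, snd (jet_chart A c) y))" for c
    by (auto simp: fun_eq_iff)
  ultimately show ?thesis by (simp add: neg_symplectization_atlas_def jet_atlas_eq image_image)
qed

text \<open>The ball will be given by its coordinates \<open>F\<close> in a single chart, whereas
  smoothness and the symplectic condition are tested in every chart. A change of chart leaves the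
  pulled-back primitive unchanged, because p dq is invariant, and by
  \<open>symplectization_form_pullback\<close> that primitive determines the pulled-back
  form.\<close>

lemma smooth_into_chart_expression:
  assumes M: "smooth_manifold A" "c \<in> A"
    and N: "open N" "smooth_on N F"
    and F: "\<And>u. u \<in> N \<Longrightarrow> fst (F u) < 0 \<and> fst (fst (snd (F u))) \<in> snd c ` fst c"
    and \<psi>: "\<And>u. \<psi> u = (fst (F u), jet_point A c (snd (F u)))"
  shows "smooth_into (neg_symplectization_atlas A) N \<psi>"
    and "\<And>u k v w. u \<in> N \<Longrightarrow> k \<in> neg_symplectization_atlas A \<Longrightarrow> \<psi> u \<in> fst k \<Longrightarrow>
      symplectization_form (snd k (\<psi> u)) (fd (snd k \<circ> \<psi>) u v) (fd (snd k \<circ> \<psi>) u w) =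
      symplectization_form (F u) (fd F u v) (fd F u w)"
proof -
  define q p z x where "q u = fst (fst (snd (F u)))" and "p u = snd (fst (snd (F u)))"
    and "z u = snd (snd (F u))" and "x u = inv_into (fst c) (snd c) (q u)" for u
  have \<psi>': "\<psi> u = (fst (F u), ((x u, covector A c (x u) (p u)), z u))" for u
    by (simp add: \<psi> jet_point_def Let_def split_beta q_def p_def z_def x_def)
  have c: "is_chart c" using smooth_manifold_chart M by blast
  have x: "x u \<in> fst c" "snd c (x u) = q u" if "u \<in> N" for u
    using F[OF that] by (auto simp: x_def q_def inv_into_into f_inv_into_f)
  have smF: "smooth_on N q" "smooth_on N p" "smooth_on N z" "smooth_on N (\<lambda>u. fst (F u))"
    unfolding q_def p_def z_def by (intro smooth_on_fst smooth_on_snd N)+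
  have main: "open {u \<in> N. \<psi> u \<in> fst k} \<and> smooth_on {u \<in> N. \<psi> u \<in> fst k} (snd k \<circ> \<psi>) \<and>
     (\<forall>u. u \<in> N \<longrightarrow> \<psi> u \<in> fst k \<longrightarrow> (\<forall>v w.
      symplectization_form (snd k (\<psi> u)) (fd (snd k \<circ> \<psi>) u v) (fd (snd k \<circ> \<psi>) u w) =
      symplectization_form (F u) (fd F u v) (fd F u w)))"
    if k: "k \<in> neg_symplectization_atlas A" for k
  proof -
    from k obtain d where d: "d \<in> A"
      and kd: "k = ({..<0} \<times> fst (jet_chart A d), \<lambda>(s, y). (s, snd (jet_chart A d) y))"
      unfolding neg_symplectization_atlas_eq by blast
    have fk: "fst k = {..<0} \<times> (Sigma (fst d) (cotangent_space A) \<times> UNIV)"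
      and sk: "snd k = (\<lambda>(s, ((x, \<xi>), z)). (s, ((snd d x, \<xi> d), z)))"
      by (simp_all add: kd jet_chart_def fun_eq_iff)
    define W where "W = snd c ` (fst c \<inter> fst d)"
    define W' where "W' = snd d ` (fst d \<inter> fst c)"
    define Nd where "Nd = {u \<in> N. \<psi> u \<in> fst k}"
    have W: "open W" "smooth_on W (transition c d)" and W': "open W'" "smooth_on W' (transition d c)"
      using smooth_manifold_transition[OF M d] smooth_manifold_transition[OF M(1) d M(2)]
      by (simp_all add: W_def W'_def)
    have Nd: "Nd = {u \<in> N. x u \<in> fst d}"
      using F covector_in_cotangent_space[OF M] x by (auto simp: Nd_def \<psi>' fk)
    have "u \<in> Nd \<longleftrightarrow> q u \<in> W" if u: "u \<in> N" for u
    proof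
      show "q u \<in> W" if "u \<in> Nd"
      proof -
        have "x u \<in> fst d" using that by (simp add: Nd)
        then have "snd c (x u) \<in> snd c ` (fst c \<inter> fst d)" using x(1)[OF u] by blast
        then show ?thesis using x(2)[OF u] by (simp add: W_def)
      qed
      assume "q u \<in> W"
      then have "snd c (x u) \<in> snd c ` (fst c \<inter> fst d)" using x(2)[OF u] by (simp add: W_def)
      then obtain y where y: "y \<in> fst c" "y \<in> fst d" "snd c (x u) = snd c y" by blast
      have "inj_on (snd c) (fst c)" using c by (simp add: is_chart_def)
      then have "x u = y" using y x(1)[OF u] by (meson inj_onD)
      with y u show "u \<in> Nd" by (simp add: Nd)
    qed
    \<comment> \<open>The part of \<open>N\<close> seen by \<open>k\<close> depends on the base
      coordinate alone, hence is an open preimage under \<open>q\<close>.\<close>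
    then have NdW: "Nd = N \<inter> q -` W" by (auto simp: Nd)
    have oNd: "open Nd" unfolding NdW
      using continuous_open_preimage[OF smooth_on_continuous[OF smF(1)] N(1) W(1)] .
    have NdN: "Nd \<subseteq> N" by (auto simp: Nd_def)
    note sm = smF[THEN smooth_on_subset, OF NdN]
    have qW: "q ` Nd \<subseteq> W" by (auto simp: NdW)
    define q' where "q' u = transition c d (q u)" for u
    have q': "q' u = snd d (x u)" if "u \<in> N" for u
      using transition_apply[OF c x(1)[OF that]] x(2)[OF that] by (simp add: q'_def)
    have smq': "smooth_on Nd q'"
      unfolding q'_def by (rule smooth_on_compose[OF oNd W(1) qW sm(1) W(2)])
    have q'W: "q' ` Nd \<subseteq> W'" using q' x(1) by (auto simp: W'_def Nd)
    \<comment> \<open>The component of the covector in the chart \<open>d\<close>, expressed through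
      \<open>q'\<close> so that its smoothness is visible.\<close>
    define p' where "p' u = (\<Sum>b\<in>Basis. (p u \<bullet> fd (transition d c) (q' u) b) *\<^sub>R b)" for u
    have smp': "smooth_on Nd p'"
      unfolding p'_def
      by (intro smooth_on_sum smooth_on_scaleR smooth_on_inner smooth_on_const sm oNd
          smooth_on_compose[OF oNd W'(1) q'W smq' smooth_on_fd[OF W'(2)]]) simp
    define G where "G u = (fst (F u), ((q' u, p' u), z u))" for u
    have G: "(snd k \<circ> \<psi>) u = G u" if "u \<in> Nd" for u
    proof -
      have "u \<in> N" "x u \<in> fst d" using that by (auto simp: Nd)
      then show ?thesis using d q' by (simp add: G_def sk \<psi>' p'_def covector_def)
    qed
    have smG: "smooth_on Nd G"
      unfolding G_def by (intro smooth_on_Pair oNd sm smq' smp')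
    have smF': "smooth_on Nd F" using smooth_on_subset[OF N(2) NdN] .
    have prim: "symplectization_primitive (G u) (fd G u v) = symplectization_primitive (F u) (fd F u v)"
      if u: "u \<in> Nd" for u v
    proof -
      have dG: "fst (fst (snd (fd G u v))) = fd q' u v" "snd (snd (fd G u v)) = fd z u v"
        using fd_bounded_linear[OF bounded_linear_jet_components(1) smooth_on_differentiable[OF smG u], of v]
          fd_bounded_linear[OF bounded_linear_jet_components(2) smooth_on_differentiable[OF smG u], of v]
        by (simp_all add: G_def)
      have dF: "fst (fst (snd (fd F u v))) = fd q u v" "snd (snd (fd F u v)) = fd z u v"
        using fd_bounded_linear[OF bounded_linear_jet_components(1) smooth_on_differentiable[OF smF' u], of v]
          fd_bounded_linear[OF bounded_linear_jet_components(2) smooth_on_differentiable[OF smF' u], of v]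
        by (simp_all add: q_def[abs_def] z_def[abs_def])
      have u': "u \<in> N" "x u \<in> fst d" using u by (auto simp: Nd)
      have "fd q' u v = fd (transition c d) (q u) (fd q u v)"
        unfolding q'_def
        by (rule fd_compose[OF smooth_on_differentiable[OF sm(1) u] smooth_on_differentiable[OF W(2)]])
          (use qW u in blast)
      then have "p' u \<bullet> fd q' u v =
          covector A c (x u) (p u) d \<bullet> fd (transition c d) (q u) (fd q u v)"
        using u' d q' by (simp add: p'_def covector_def)
      also have "\<dots> = p u \<bullet> fd (transition d c) (snd d (x u)) (fd (transition c d) (snd c (x u)) (fd q u v))"
        using u' x by (simp add: covector_inner[OF M d])
      \<comment> \<open>Going from \<open>c\<close> to \<open>d\<close> and back is
        \<open>transition c c\<close>, whose derivative is the identity: this is the invariance of p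
        dq.\<close>
      also have "\<dots> = p u \<bullet> fd q u v"
        using transition_cocycle[OF M d M(2), of "x u" "fd q u v"] x(1)[OF u'(1)] u'(2)
          fd_transition_self[OF M x(1)[OF u'(1)], of "fd q u v"] by simp
      finally show ?thesis
        by (simp add: symplectization_primitive_eq dF dG) (simp add: G_def p_def)
    qed
    have "symplectization_form (snd k (\<psi> u)) (fd (snd k \<circ> \<psi>) u v) (fd (snd k \<circ> \<psi>) u w) =
      symplectization_form (F u) (fd F u v) (fd F u w)" if u: "u \<in> Nd" for u v w
    proof -
      have "fd (snd k \<circ> \<psi>) u = fd G u" using fd_cong_open[OF oNd u G] .
      then have "symplectization_form (snd k (\<psi> u)) (fd (snd k \<circ> \<psi>) u v) (fd (snd k \<circ> \<psi>) u w) =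
          symplectization_form (G u) (fd G u v) (fd G u w)"
        using G[OF u] by simp
      also have "\<dots> = symplectization_form (F u) (fd F u v) (fd F u w)"
        unfolding symplectization_form_pullback[OF oNd smG u] symplectization_form_pullback[OF oNd smF' u]
        by (intro arg_cong2[where f = "(-)"] fun_cong[OF fd_cong_open[OF oNd u]] prim)
      finally show ?thesis .
    qed
    moreover have "smooth_on Nd (snd k \<circ> \<psi>)"
      by (rule smooth_on_cong[OF oNd G[symmetric] smG])
    ultimately show ?thesis using oNd by (auto simp: Nd_def)
  qed
  have "\<psi> ` N \<subseteq> carrier (neg_symplectization_atlas A)"
  proof (rule image_subsetI)
    fix u
    assume u: "u \<in> N"
    have "\<psi> u \<in> {..<0} \<times> (Sigma (fst c) (cotangent_space A) \<times> UNIV)"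
      using F[OF u] x[OF u] covector_in_cotangent_space[OF M] by (simp add: \<psi>')
    then show "\<psi> u \<in> carrier (neg_symplectization_atlas A)"
      using M(2) unfolding carrier_def neg_symplectization_atlas_eq jet_chart_def by auto
  qed
  with main N(1) show "smooth_into (neg_symplectization_atlas A) N \<psi>"
    by (simp add: smooth_into_def)
  show "symplectization_form (snd k (\<psi> u)) (fd (snd k \<circ> \<psi>) u v) (fd (snd k \<circ> \<psi>) u w) =
      symplectization_form (F u) (fd F u v) (fd F u w)"
    if "u \<in> N" "k \<in> neg_symplectization_atlas A" "\<psi> u \<in> fst k" for u k v w
    using main that by blast
qed

section \<open>Topology of manifolds and tangent vectors of submanifolds\<close>

lemma topspace_manifold_topology: "topspace (manifold_topology A) = carrier A"
proof -
  have "\<Union> {{x \<in> fst c. snd c x \<in> W} | c W. c \<in> A \<and> open W} = carrier A"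
  proof (intro equalityI subsetI)
    fix x
    assume "x \<in> carrier A"
    then obtain c where "c \<in> A" "x \<in> {x \<in> fst c. snd c x \<in> UNIV}" by (auto simp: carrier_def)
    then show "x \<in> \<Union> {{x \<in> fst c. snd c x \<in> W} | c W. c \<in> A \<and> open W}"
      using open_UNIV by blast
  next
    fix x
    assume "x \<in> \<Union> {{x \<in> fst c. snd c x \<in> W} | c W. c \<in> A \<and> open W}"
    then show "x \<in> carrier A" unfolding carrier_def by blast
  qed
  then show ?thesis by (simp add: manifold_topology_def topology_generated_by_topspace)
qed

lemma openin_manifold_topology_chart:
  "c \<in> A \<Longrightarrow> open W \<Longrightarrow> openin (manifold_topology A) {x \<in> fst c. snd c x \<in> W}"
  unfolding manifold_topology_def by (rule topology_generated_by_Basis) blast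

text \<open>The topology is generated by the charts of the given atlas, so a set described in a
  chart of the maximal atlas is rewritten as a union of pieces seen in atlas charts, open there by
  continuity of the transition. Injectivity of the charts is what \<open>jet_chart_inj\<close>
  supplies for the jet atlas.\<close>

lemma openin_manifold_topology_compatible_chart:
  assumes inj: "\<And>c. c \<in> B \<Longrightarrow> inj_on (snd c) (fst c)"
    and d: "compatible_chart B d" and V: "open V"
  shows "openin (manifold_topology B) {y \<in> fst d. snd d y \<in> V}"
proof -
  define W where "W c = snd c ` (fst c \<inter> fst d) \<inter> transition c d -` V" for c
  have "{y \<in> fst d. snd d y \<in> V} = (\<Union>c\<in>B. {y \<in> fst c. snd c y \<in> W c})"
  proof (intro equalityI subsetI)
    fix y
    assume y: "y \<in> {y \<in> fst d. snd d y \<in> V}"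
    with d obtain c where c: "c \<in> B" "y \<in> fst c"
      by (auto simp: compatible_chart_def carrier_def)
    have "transition c d (snd c y) = snd d y"
      using inj[OF c(1)] c(2) by (simp add: transition_def)
    with y c show "y \<in> (\<Union>c\<in>B. {y \<in> fst c. snd c y \<in> W c})" by (auto simp: W_def)
  next
    fix y
    assume "y \<in> (\<Union>c\<in>B. {y \<in> fst c. snd c y \<in> W c})"
    then obtain c where c: "c \<in> B" "y \<in> fst c" "snd c y \<in> W c" by blast
    then obtain y' where "y' \<in> fst c" "y' \<in> fst d" "snd c y = snd c y'" by (auto simp: W_def)
    with inj[OF c(1)] c(2) have "y \<in> fst d" by (metis inj_onD)
    moreover have "transition c d (snd c y) = snd d y"
      using inj[OF c(1)] c(2) by (simp add: transition_def)
    ultimately show "y \<in> {y \<in> fst d. snd d y \<in> V}" using c(3) by (simp add: W_def)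
  qed
  moreover have "open (W c)" if "c \<in> B" for c
  proof -
    have "smooth_transition c d" using d that by (simp add: compatible_chart_def)
    then show ?thesis
      unfolding W_def smooth_transition_def using V
      by (intro continuous_open_preimage smooth_on_continuous) auto
  qed
  ultimately show ?thesis by (auto intro!: openin_manifold_topology_chart)
qed

text \<open>A straight segment in the slice \<open>L\<close> lifts to a smooth curve in
  \<open>S\<close> whose velocity in \<open>e\<close> is the image of \<open>w\<close>. Through such
  vectors both the contact condition and the immersion condition on the front enter the
  proof.\<close>

lemma slice_tangent:
  fixes B :: "('m, 'e::euclidean_space) chart set"
  assumes d: "compatible_chart B d" and L: "subspace L" "snd d ` (fst d \<inter> S) = snd d ` fst d \<inter> L"
    and y: "y \<in> S" "y \<in> fst d" "e \<in> B" "y \<in> fst e" and w: "w \<in> L"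
  shows "fd (transition d e) (snd d y) w \<in> tangent_space B S e y"
proof -
  have dc: "inj_on (snd d) (fst d)" "open (snd d ` fst d)" "fst d \<subseteq> carrier B"
    and tr: "\<And>e. e \<in> B \<Longrightarrow> smooth_transition d e"
    using d by (auto simp: compatible_chart_def is_chart_def)
  define a where "a = snd d y"
  define l where "l t = a + t *\<^sub>R w" for t :: real
  have aL: "a \<in> L" using L(2) y unfolding a_def by blast
  have lc: "isCont l t" for t unfolding l_def by (intro continuous_intros)
  have "open (l -` (snd d ` fst d))" by (rule continuous_open_vimage[OF dc(2) lc])
  moreover have "0 \<in> l -` (snd d ` fst d)" using y by (simp add: l_def a_def)
  ultimately obtain \<epsilon> where \<epsilon>: "\<epsilon> > 0" "ball 0 \<epsilon> \<subseteq> l -` (snd d ` fst d)" by (meson openE)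
  then have l: "l t \<in> snd d ` fst d" if "t \<in> {-\<epsilon><..<\<epsilon>}" for t
    using that by (auto simp: subset_iff dist_real_def)
  define g where "g t = inv_into (fst d) (snd d) (l t)" for t
  have g: "g t \<in> fst d" "snd d (g t) = l t" if "t \<in> {-\<epsilon><..<\<epsilon>}" for t
    using l[OF that] by (auto simp: g_def inv_into_into f_inv_into_f)
  have sml: "smooth_on T l" if "open T" for T
    unfolding l_def by (intro smooth_on_add smooth_on_scaleR smooth_on_const smooth_on_id that)
  have se: "(snd e \<circ> g) = (\<lambda>t. transition d e (l t))" for e :: "('m, 'e) chart"
    by (simp add: fun_eq_iff transition_def g_def)
  have gS: "g t \<in> S" if t: "t \<in> {-\<epsilon><..<\<epsilon>}" for t
  proof -
    have "l t \<in> L" using L(1) aL w by (simp add: l_def subspace_add subspace_scale)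
    then have "l t \<in> snd d ` (fst d \<inter> S)" using L(2) l[OF t] by blast
    then obtain y' where "y' \<in> fst d" "y' \<in> S" "snd d (g t) = snd d y'" using g[OF t] by auto
    with dc(1) g(1)[OF t] show ?thesis by (metis inj_onD)
  qed
  have "smooth_into B {-\<epsilon><..<\<epsilon>} g"
    unfolding smooth_into_def
  proof (intro conjI ballI)
    show "g ` {-\<epsilon><..<\<epsilon>} \<subseteq> carrier B" using g(1) dc(3) by blast
    fix e
    assume e: "e \<in> B"
    let ?I = "{u \<in> {-\<epsilon><..<\<epsilon>}. g u \<in> fst e}"
    have eq: "?I = {-\<epsilon><..<\<epsilon>} \<inter> l -` (snd d ` (fst d \<inter> fst e))"
    proof -
      have "g t \<in> fst e \<longleftrightarrow> l t \<in> snd d ` (fst d \<inter> fst e)" if t: "t \<in> {-\<epsilon><..<\<epsilon>}" for t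
      proof
        show "l t \<in> snd d ` (fst d \<inter> fst e)" if "g t \<in> fst e"
          using that g[OF t] by (intro image_eqI[of _ _ "g t"]) auto
        assume "l t \<in> snd d ` (fst d \<inter> fst e)"
        then obtain y' where "y' \<in> fst d" "y' \<in> fst e" "snd d (g t) = snd d y'" using g[OF t] by auto
        with dc(1) g(1)[OF t] show "g t \<in> fst e" by (metis inj_onD)
      qed
      then show ?thesis by auto
    qed
    have "open (l -` (snd d ` (fst d \<inter> fst e)))"
      using tr[OF e] by (intro continuous_open_vimage lc) (simp add: smooth_transition_def)
    then show o: "open ?I" unfolding eq by (intro open_Int) auto
    have "l ` ?I \<subseteq> snd d ` (fst d \<inter> fst e)" unfolding eq by blast
    moreover have "open (snd d ` (fst d \<inter> fst e))" "smooth_on (snd d ` (fst d \<inter> fst e)) (transition d e)"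
      using tr[OF e] by (simp_all only: smooth_transition_def)
    ultimately show "smooth_on ?I (snd e \<circ> g)"
      unfolding se using smooth_on_compose[OF o _ _ sml[OF o], of _ "transition d e"] by blast
  qed simp
  moreover have "g 0 = y" using dc(1) y(2) by (simp add: g_def l_def a_def)
  moreover have "((snd e \<circ> g) has_vector_derivative fd (transition d e) (snd d y) w) (at 0)"
  proof -
    have "smooth_on (snd d ` (fst d \<inter> fst e)) (transition d e)"
      using tr[OF y(3)] by (simp add: smooth_transition_def)
    then have D: "(transition d e has_derivative fd (transition d e) a) (at a)"
      using y by (intro smooth_on_has_derivative) (auto simp: a_def)
    have "(l has_derivative (\<lambda>t. t *\<^sub>R w)) (at 0)"
      unfolding l_def by (auto intro!: derivative_eq_intros)
    moreover have "(transition d e has_derivative fd (transition d e) a) (at (l 0))"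
      using D by (simp add: l_def)
    ultimately have "((\<lambda>t. transition d e (l t)) has_derivative (\<lambda>t. fd (transition d e) a (t *\<^sub>R w))) (at 0)"
      by (rule has_derivative_compose)
    then show ?thesis
      using has_derivative_linear[OF D]
      by (simp add: se has_vector_derivative_def linear_scale a_def)
  qed
  ultimately show ?thesis using \<epsilon>(1) gS unfolding tangent_space_def by blast
qed

lemma jet_chart_inj:
  assumes "smooth_manifold A" "c \<in> A"
  shows "inj_on (snd (jet_chart A c)) (fst (jet_chart A c))"
proof (rule inj_onI)
  fix y y'
  assume *: "y \<in> fst (jet_chart A c)" "y' \<in> fst (jet_chart A c)"
    "snd (jet_chart A c) y = snd (jet_chart A c) y'"
  obtain x \<xi> z x' \<xi>' z' where y: "y = ((x, \<xi>), z)" "y' = ((x', \<xi>'), z')" by (metis surj_pair)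
  have x: "x \<in> fst c" "x' \<in> fst c" "\<xi> \<in> cotangent_space A x" "\<xi>' \<in> cotangent_space A x'"
    and eq: "snd c x = snd c x'" "\<xi> c = \<xi>' c" "z = z'"
    using * by (auto simp: y jet_chart_def)
  have *: "x = x'" using smooth_manifold_chart[OF assms] eq(1) x by (auto simp: is_chart_def dest: inj_onD)
  have "\<xi> = \<xi>'"
    using covector_unique[OF assms x(1,3), unfolded * eq(2)]
      covector_unique[OF assms x(2,4)] by (rule trans[OF sym])
  with * show "y = y'" by (simp add: y eq(3))
qed

lemma continuous_map_proj_x:
  "continuous_map (manifold_topology (jet_atlas A)) (manifold_topology A) proj_x"
proof -
  let ?T = "manifold_topology (jet_atlas A)"
  have carrier: "y \<in> carrier (jet_atlas A) \<longleftrightarrow> (\<exists>c\<in>A. y \<in> fst (jet_chart A c))" for y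
    by (auto simp: carrier_def jet_atlas_eq)
  have "openin ?T (proj_x -` {x \<in> fst c. snd c x \<in> W} \<inter> topspace ?T)" if "c \<in> A" "open W" for c W
  proof -
    have "proj_x -` {x \<in> fst c. snd c x \<in> W} \<inter> topspace ?T =
        {y \<in> fst (jet_chart A c). snd (jet_chart A c) y \<in> (W \<times> UNIV) \<times> UNIV}"
      using that(1) unfolding topspace_manifold_topology carrier
      by (auto simp: jet_chart_def proj_x_def carrier)
    moreover have "openin ?T \<dots>"
      using that by (intro openin_manifold_topology_chart open_Times) (auto simp: jet_atlas_eq)
    ultimately show ?thesis by simp
  qed
  moreover have "proj_x ` topspace ?T \<subseteq> \<Union> {{x \<in> fst c. snd c x \<in> W} | c W. c \<in> A \<and> open W}"
  proof (rule image_subsetI)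
    fix y
    assume "y \<in> topspace ?T"
    then obtain c where "c \<in> A" "y \<in> fst (jet_chart A c)"
      by (auto simp: topspace_manifold_topology carrier)
    then have "proj_x y \<in> {x \<in> fst c. snd c x \<in> UNIV}" "c \<in> A"
      by (auto simp: jet_chart_def proj_x_def)
    then show "proj_x y \<in> \<Union> {{x \<in> fst c. snd c x \<in> W} | c W. c \<in> A \<and> open W}"
      using open_UNIV by blast
  qed
  ultimately show ?thesis
    unfolding manifold_topology_def[of A] continuous_on_generated_topo_iff by blast
qed

lemma continuous_map_proj_z:
  "continuous_map (manifold_topology (jet_atlas A)) euclideanreal proj_z"
  unfolding continuous_map_def
proof (intro conjI allI impI)
  fix W :: "real set"
  assume "openin euclidean W"
  then have W: "open W" by simp
  have "{y \<in> topspace (manifold_topology (jet_atlas A)). proj_z y \<in> W} =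
      (\<Union>k\<in>jet_atlas A. {y \<in> fst k. snd k y \<in> UNIV \<times> W})"
    by (auto simp: topspace_manifold_topology carrier_def jet_atlas_eq jet_chart_def proj_z_def)
  then show "openin (manifold_topology (jet_atlas A))
      {y \<in> topspace (manifold_topology (jet_atlas A)). proj_z y \<in> W}"
    using W by (auto intro!: openin_manifold_topology_chart open_Times)
qed simp

section \<open>Legendrian submanifolds as 1-jet graphs\<close>

text \<open>Along \<Lambda> the contact condition reads dz = p dq. So a tangent vector without base
  component has no \<open>z\<close> component either, and away from the front singularities the base
  coordinates have injective derivative on \<Lambda>. The inverse function theorem makes them local
  coordinates of \<Lambda>, and dz = p dq written in them says that \<open>P\<close> is the gradient
  of \<open>f\<close>.\<close>

lemma legendrian_local_graph:
  fixes A :: "('m, 'e::euclidean_space) chart set"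
  assumes M: "smooth_manifold A" "c \<in> A" and leg: "legendrian A \<Lambda>"
    and y0: "y0 \<in> \<Lambda>" "proj_x y0 \<in> fst c" "front_proj y0 \<notin> front_singularities A \<Lambda>"
  obtains V f P W where
    "open V" "snd c (proj_x y0) \<in> V" "V \<subseteq> snd c ` fst c" "smooth_on V f" "smooth_on V P"
    "\<And>q v. q \<in> V \<Longrightarrow> fd f q v = P q \<bullet> v"
    "f (snd c (proj_x y0)) = proj_z y0"
    "\<And>q. q \<in> V \<Longrightarrow> \<exists>y\<in>\<Lambda>. y \<in> fst (jet_chart A c) \<and> snd (jet_chart A c) y = ((q, P q), f q)"
    "openin (manifold_topology (jet_atlas A)) W" "y0 \<in> W"
    "\<And>y. y \<in> \<Lambda> \<inter> W \<Longrightarrow> y \<in> fst (jet_chart A c) \<and>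
      (\<exists>q\<in>V. snd (jet_chart A c) y = ((q, P q), f q))"
proof -
  define B where "B = jet_atlas A"
  define k where "k = jet_chart A c"
  have kB: "k \<in> B" using M by (simp add: B_def k_def jet_atlas_eq)
  have Binj: "inj_on (snd e) (fst e)" if "e \<in> B" for e
    using that jet_chart_inj[OF M(1)] by (auto simp: B_def jet_atlas_eq)
  have sub: "embedded_submanifold B DIM('e) \<Lambda>"
    and contact: "\<And>y e v. y \<in> \<Lambda> \<Longrightarrow> e \<in> B \<Longrightarrow> y \<in> fst e \<Longrightarrow> v \<in> tangent_space B \<Lambda> e y \<Longrightarrow>
      contact_form (snd e y) v = 0"
    using leg by (auto simp: legendrian_def B_def)
  have y0k: "y0 \<in> fst k"
  proof -
    have "y0 \<in> carrier B" using sub y0(1) by (auto simp: embedded_submanifold_def)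
    then show ?thesis using y0(2)
      by (auto simp: carrier_def B_def jet_atlas_eq jet_chart_def k_def proj_x_def)
  qed
  have kq: "fst (fst (snd k y)) = snd c (proj_x y)" "snd (snd k y) = proj_z y" for y
    by (auto simp: k_def jet_chart_def proj_x_def proj_z_def split_beta)
  have kc: "proj_x y \<in> fst c" if "y \<in> fst k" for y
    using that by (auto simp: k_def jet_chart_def proj_x_def)
  obtain d L where d: "compatible_chart B d" "y0 \<in> fst d" and L: "subspace L" "dim L = DIM('e)"
    "snd d ` (fst d \<inter> \<Lambda>) = snd d ` fst d \<inter> L"
    using sub y0(1) unfolding embedded_submanifold_def by blast
  have dinj: "inj_on (snd d) (fst d)" using d by (simp add: compatible_chart_def is_chart_def)
  define D where "D = snd d ` (fst d \<inter> fst k)"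
  define \<tau> where "\<tau> = transition d k"
  have D: "open D" "smooth_on D \<tau>" and D': "smooth_transition k d"
    using d kB by (auto simp: compatible_chart_def smooth_transition_def D_def \<tau>_def)
  have \<tau>: "\<tau> (snd d y) = snd k y" if "y \<in> fst d" for y
    using dinj that by (simp add: \<tau>_def transition_def)
  have \<Lambda>L: "y \<in> \<Lambda> \<longleftrightarrow> snd d y \<in> L" if y: "y \<in> fst d" for y
  proof
    show "snd d y \<in> L" if "y \<in> \<Lambda>" using that y L(3) by blast
    assume "snd d y \<in> L"
    then have "snd d y \<in> snd d ` (fst d \<inter> \<Lambda>)" using y L(3) by blast
    then obtain y' where y': "y' \<in> fst d" "y' \<in> \<Lambda>" "snd d y = snd d y'" by blast
    with inj_onD[OF dinj y'(3) y y'(1)] show "y \<in> \<Lambda>" by simp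
  qed
  \<comment> \<open>Parametrizes the slice by \<open>'e\<close>, so that the base coordinate becomes
    a map from \<open>'e\<close> to itself, ready for the inverse function theorem; the left inverse
    \<open>m\<close> later cuts out \<open>W\<close>.\<close>
  obtain l :: "'e \<Rightarrow> ('e \<times> 'e) \<times> real" and m where l: "linear l" "linear m" "range l = L" "\<And>x. m (l x) = x"
    using isometries_subspaces[of "UNIV :: 'e set" L] L(1,2) by (metis UNIV_I dim_UNIV subspace_UNIV)
  have bl: "bounded_linear l" "bounded_linear m" using l linear_conv_bounded_linear by blast+
  define O' where "O' = l -` D"
  have oO: "open O'" unfolding O'_def
    using D(1) linear_continuous_at[OF bl(1)] by (intro continuous_open_vimage) auto
  define G where "G u = \<tau> (l u)" for u
  have sml: "smooth_on O' l" by (intro smooth_on_bounded_linear[OF oO bl(1)] smooth_on_id oO)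
  have smG: "smooth_on O' G"
    unfolding G_def by (rule smooth_on_compose[OF oO D(1) _ sml D(2)]) (auto simp: O'_def)
  have Gpt: "\<exists>y\<in>\<Lambda>. y \<in> fst d \<and> y \<in> fst k \<and> snd d y = l u \<and> snd k y = G u" if "u \<in> O'" for u
  proof -
    have "l u \<in> snd d ` (fst d \<inter> fst k)" using that by (simp add: O'_def D_def)
    then obtain y where y: "y \<in> fst d" "y \<in> fst k" "snd d y = l u" by auto
    moreover have "l u \<in> L" using l(3) by blast
    ultimately have "y \<in> \<Lambda>" "snd k y = G u" using \<Lambda>L[OF y(1)] \<tau>[OF y(1)] by (simp_all add: G_def)
    with y show ?thesis by blast
  qed
  have fdG: "fd G u v = fd \<tau> (l u) (l v)" if "u \<in> O'" for u v
  proof -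
    have "fd l u v = l v" by (rule fd_eq) (rule bounded_linear_imp_has_derivative[OF bl(1)])
    moreover have "l u \<in> D" using that by (simp add: O'_def)
    ultimately show ?thesis
      unfolding G_def using smooth_on_differentiable[OF sml that] smooth_on_differentiable[OF D(2)]
      by (simp add: fd_compose)
  qed
  have tangent: "fd G u v \<in> tangent_space B \<Lambda> k y" if "u \<in> O'" "y \<in> \<Lambda>" "y \<in> fst d" "y \<in> fst k" "snd d y = l u" for u v y
    using slice_tangent[OF d(1) L(1,3) that(2,3) kB that(4), of "l v"] l(3) fdG[OF that(1)] that(5)
    by (auto simp: \<tau>_def)
  have Gcontact: "snd (fd G u v) = snd (fst (G u)) \<bullet> fst (fst (fd G u v))" if u: "u \<in> O'" for u v
  proof -
    obtain y where y: "y \<in> \<Lambda>" "y \<in> fst d" "y \<in> fst k" "snd d y = l u" "snd k y = G u"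
      using Gpt[OF u] by blast
    from contact[OF y(1) kB y(3) tangent[OF u y(1-4)]] y(5) show ?thesis
      by (simp add: contact_form_def canonical_form_def split_beta)
  qed
  define Q where "Q u = fst (fst (G u))" for u
  have smQ: "smooth_on O' Q" unfolding Q_def by (intro smooth_on_fst oO smG)
  have blf: "bounded_linear (\<lambda>y :: ('e \<times> 'e) \<times> real. fst (fst y))"
    by (intro bounded_linear_fst_comp bounded_linear_ident)
  have fdQ: "fd Q u v = fst (fst (fd G u v))" if "u \<in> O'" for u v
    unfolding Q_def using fd_bounded_linear[OF blf smooth_on_differentiable[OF smG that]] .
  obtain u0 where u0: "l u0 = snd d y0" using \<Lambda>L[OF d(2)] y0(1) l(3) by (metis rangeE)
  have u0O: "u0 \<in> O'" using imageI[of y0 "fst d \<inter> fst k" "snd d"] d(2) y0k by (simp add: O'_def D_def u0)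
  \<comment> \<open>The parametrization \<open>G\<close> is an immersion: the opposite transition
    undoes \<open>\<tau>\<close>, so its derivative undoes that of \<open>\<tau>\<close>, and
    \<open>l\<close> is undone by \<open>m\<close>.\<close>
  have kerG: "v = 0" if "fd G u0 v = 0" for v
  proof -
    have "smooth_on (snd k ` (fst k \<inter> fst d)) (transition k d)" using D' by (simp add: smooth_transition_def)
    then have diff: "transition k d differentiable at (\<tau> (l u0))"
      using y0k d(2) by (intro smooth_on_differentiable) (auto simp: u0 \<tau>)
    have u0D: "l u0 \<in> D" using u0O by (simp add: O'_def)
    have "fd (\<lambda>w. transition k d (\<tau> w)) (l u0) (l v) = fd (\<lambda>w. w) (l u0) (l v)"
    proof (rule fun_cong[OF fd_cong_open[OF D(1) u0D]])
      fix w
      assume "w \<in> D"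
      then show "transition k d (\<tau> w) = w"
        using \<tau> Binj[OF kB] by (auto simp: D_def transition_def)
    qed
    then have "l v = fd (transition k d) (\<tau> (l u0)) (fd \<tau> (l u0) (l v))"
      using fd_compose[OF smooth_on_differentiable[OF D(2) u0D] diff] fd_eq[OF has_derivative_ident]
      by metis
    also have "\<dots> = 0"
      using that fdG[OF u0O] linear_0[OF linear_frechet_derivative[OF diff]] by simp
    finally show "v = 0" using l(4)[of v] linear_0[OF l(2)] by simp
  qed
  have "inj (fd Q u0)"
  proof (rule linear_injective_0[THEN iffD2, OF smooth_on_linear_fd[OF smQ u0O]], intro allI impI)
    fix v
    assume "fd Q u0 v = 0"
    then have "front_proj (fd G u0 v) = 0"
      using Gcontact[OF u0O, of v] by (simp add: fdQ[OF u0O] front_proj_def proj_x_def proj_z_def zero_prod_def)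
    moreover have "fd G u0 v \<in> tangent_space B \<Lambda> k y0"
      by (rule tangent[OF u0O y0(1) d(2) y0k u0[symmetric]])
    ultimately have "fd G u0 v = 0"
      using y0(1,3) y0k kB unfolding front_singularities_def B_def by blast
    then show "v = 0" by (rule kerG)
  qed
  then obtain U V \<phi> where U: "open U" "U \<subseteq> O'" "u0 \<in> U" "open V" "homeomorphism U V Q \<phi>" "smooth_on V \<phi>"
    using smooth_inverse_function[OF oO smQ u0O] by blast
  have \<phi>: "\<phi> q \<in> U" "Q (\<phi> q) = q" if "q \<in> V" for q
    using U(5) that by (auto simp: homeomorphism_def)
  have Q: "Q u \<in> V" "\<phi> (Q u) = u" if "u \<in> U" for u
    using U(5) that by (auto simp: homeomorphism_def)
  have \<phi>O: "\<phi> q \<in> O'" if "q \<in> V" for q using \<phi>(1)[OF that] U(2) by blast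
  define f where "f q = snd (G (\<phi> q))" for q
  define P where "P q = snd (fst (G (\<phi> q)))" for q
  have G: "G (\<phi> q) = ((q, P q), f q)" if "q \<in> V" for q
    using \<phi>(2)[OF that] by (simp add: P_def f_def Q_def prod_eq_iff)
  have smG\<phi>: "smooth_on V (\<lambda>q. G (\<phi> q))"
    by (rule smooth_on_compose[OF U(4) oO _ U(6) smG]) (use \<phi>O in auto)
  note goal = that
  show ?thesis
  proof (rule goal)
    show "open V" by (rule U(4))
    have Qu0: "Q u0 = snd c (proj_x y0)" using \<tau>[OF d(2)] by (simp add: Q_def G_def u0 kq)
    then show q0: "snd c (proj_x y0) \<in> V" using Q(1)[OF U(3)] by simp
    show pts: "\<exists>y\<in>\<Lambda>. y \<in> fst (jet_chart A c) \<and> snd (jet_chart A c) y = ((q, P q), f q)" if "q \<in> V" for q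
      using Gpt[OF \<phi>O[OF that]] G[OF that] unfolding k_def by auto
    show "V \<subseteq> snd c ` fst c"
    proof
      fix q
      assume "q \<in> V"
      from pts[OF this] obtain y where "y \<in> fst k" "snd k y = ((q, P q), f q)" unfolding k_def by blast
      with kc kq(1)[of y] show "q \<in> snd c ` fst c" by auto
    qed
    show "smooth_on V f" "smooth_on V P"
      unfolding f_def P_def by (intro smooth_on_fst smooth_on_snd U(4) smG\<phi>)+
    show "fd f q v = P q \<bullet> v" if q: "q \<in> V" for q v
    proof -
      have dG\<phi>: "fd (\<lambda>q. G (\<phi> q)) q v = fd G (\<phi> q) (fd \<phi> q v)"
        by (rule fd_compose[OF smooth_on_differentiable[OF U(6) q] smooth_on_differentiable[OF smG \<phi>O[OF q]]])
      have "fd f q v = snd (fd (\<lambda>q. G (\<phi> q)) q v)"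
        unfolding f_def using fd_bounded_linear[OF bounded_linear_snd smooth_on_differentiable[OF smG\<phi> q]] .
      also have "\<dots> = P q \<bullet> fst (fst (fd (\<lambda>q. G (\<phi> q)) q v))"
        by (simp add: dG\<phi> Gcontact[OF \<phi>O[OF q]] P_def)
      also have "fst (fst (fd (\<lambda>q. G (\<phi> q)) q v)) = fd (\<lambda>q. fst (fst (G (\<phi> q)))) q v"
        by (rule fd_bounded_linear[OF blf smooth_on_differentiable[OF smG\<phi> q], symmetric])
      also have "\<dots> = fd (\<lambda>q. q) q v"
        by (rule fun_cong[OF fd_cong_open[OF U(4) q]]) (simp add: G)
      finally show ?thesis by (simp add: fd_eq[OF has_derivative_ident])
    qed
    show "f (snd c (proj_x y0)) = proj_z y0"
      using Q(2)[OF U(3)] \<tau>[OF d(2)] by (simp add: f_def Qu0 G_def u0 kq)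
    \<comment> \<open>On \<Lambda> the slice coordinate is \<open>l u\<close>, so \<open>m\<close>
      recovers \<open>u\<close> and membership in \<open>W\<close> forces \<open>u \<in> U\<close>,
      where the graph description holds. Stated through \<open>m\<close>, this is an open condition
      on the whole jet space and not just on \<Lambda>.\<close>
    define W where "W = {y \<in> fst d. snd d y \<in> m -` U} \<inter> {y \<in> fst k. snd k y \<in> UNIV}"
    have "open (m -` U)" using U(1) linear_continuous_at[OF bl(2)] by (intro continuous_open_vimage) auto
    then have "openin (manifold_topology B) W"
      unfolding W_def using openin_manifold_topology_compatible_chart[OF Binj d(1)]
        openin_manifold_topology_chart[OF kB open_UNIV] by blast
    then show "openin (manifold_topology (jet_atlas A)) W" by (simp add: B_def)
    show "y0 \<in> W" using d(2) y0k U(3) l(4)[of u0] by (simp add: W_def u0)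
    show "y \<in> fst (jet_chart A c) \<and> (\<exists>q\<in>V. snd (jet_chart A c) y = ((q, P q), f q))"
      if "y \<in> \<Lambda> \<inter> W" for y
    proof -
      from that have y: "y \<in> \<Lambda>" "y \<in> fst d" "y \<in> fst k" "m (snd d y) \<in> U" by (auto simp: W_def)
      then obtain u where u: "snd d y = l u" using \<Lambda>L[OF y(2)] l(3) by (metis rangeE)
      with y(4) l(4) have uU: "u \<in> U" by simp
      have "snd k y = G u" using \<tau>[OF y(2)] by (simp add: G_def u)
      also have "\<dots> = ((Q u, P (Q u)), f (Q u))" using G[OF Q(1)[OF uU]] Q(2)[OF uU] by simp
      finally show ?thesis using y(3) Q(1)[OF uU] unfolding k_def by blast
    qed
  qed
qed

section \<open>The symplectic ball\<close>

text \<open>The area preserving map \<open>(x, y) \<mapsto> (T x, y / w x)\<close> with \<open>w = T'\<close> sends the disk of radius \<open>r\<close>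
  into \<open>(0, 1) \<times> (- h, h)\<close> as soon as \<open>w x > sqrt (r\<^sup>2 - x\<^sup>2) / h\<close>; the integral of the right hand
  side is \<open>pi * r\<^sup>2 / (2 * h) < 1\<close>, which leaves room for such a \<open>w\<close> of integral less than 1.\<close>

lemma disk_into_rectangle:
  fixes r h :: real
  assumes "r > 0" "pi * r\<^sup>2 < 2 * h"
  obtains \<rho> T w where "r < \<rho>" "smooth_on {-\<rho><..<\<rho>} w"
    "\<And>x. \<bar>x\<bar> < \<rho> \<Longrightarrow> 0 < T x \<and> T x < 1 \<and> 0 < w x \<and> (T has_real_derivative w x) (at x)"
    "\<And>x y. x\<^sup>2 + y\<^sup>2 \<le> r\<^sup>2 \<Longrightarrow> \<bar>y\<bar> / w x < h"
proof -
  have "r\<^sup>2 < 2 * h / pi" using assms(2) by (simp add: field_simps)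
  \<comment> \<open>A slightly larger disk that still satisfies the area bound: \<open>w\<close>
    vanishes only on its boundary, so it stays positive and smooth near the disk of radius
    \<open>r\<close>.\<close>
  then obtain R where R: "r\<^sup>2 < R" "R < 2 * h / pi" using dense by blast
  define \<rho> where "\<rho> = sqrt R"
  have R0: "R > 0" using R(1) by (smt (verit) zero_le_power2)
  then have \<rho>2: "\<rho>\<^sup>2 = R" by (simp add: \<rho>_def)
  have \<rho>: "\<rho> > 0" using R0 by (simp add: \<rho>_def)
  have r\<rho>: "r < \<rho>" using R(1) assms(1) by (simp add: \<rho>_def real_less_rsqrt)
  have h: "h > 0" using assms(2) by (smt (verit) mult_nonneg_nonneg pi_ge_zero zero_le_power2)
  have lt: "pi * \<rho>\<^sup>2 < 2 * h" using R(2) by (simp add: \<rho>2 field_simps)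
  define w where "w x = sqrt (\<rho>\<^sup>2 - x\<^sup>2) / h" for x
  \<comment> \<open>The classical antiderivative of \<open>w\<close>. The constant 1/2 centres its
    range: the end values are \<open>1 / 2 - pi * \<rho>\<^sup>2 / (4 * h)\<close> and
    \<open>1 / 2 + pi * \<rho>\<^sup>2 / (4 * h)\<close>, strictly between 0 and 1 exactly when
    \<open>pi * \<rho>\<^sup>2 < 2 * h\<close>.\<close>
  define T where "T x = 1 / 2 + (x * sqrt (\<rho>\<^sup>2 - x\<^sup>2) + \<rho>\<^sup>2 * arcsin (x / \<rho>)) / (2 * h)" for x
  have pos: "\<rho>\<^sup>2 - x\<^sup>2 > 0" if "\<bar>x\<bar> < \<rho>" for x
    using power_strict_mono[OF that, of 2] by simp
  have w: "w x > 0" if "\<bar>x\<bar> < \<rho>" for x using pos[OF that] h by (simp add: w_def)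
  have dT: "(T has_real_derivative w x) (at x)" if x: "\<bar>x\<bar> < \<rho>" for x
  proof -
    have s: "sqrt (1 - (x / \<rho>)\<^sup>2) = sqrt (\<rho>\<^sup>2 - x\<^sup>2) / \<rho>"
    proof -
      have "1 - (x / \<rho>)\<^sup>2 = (\<rho>\<^sup>2 - x\<^sup>2) / \<rho>\<^sup>2" using \<rho> by (simp add: field_simps)
      then show ?thesis using \<rho> by (simp add: real_sqrt_divide)
    qed
    have b: "-1 < x / \<rho>" "x / \<rho> < 1" using x \<rho> by (auto simp: field_simps abs_less_iff)
    define S where "S = sqrt (\<rho>\<^sup>2 - x\<^sup>2)"
    have S: "S > 0" "S * S = \<rho>\<^sup>2 - x\<^sup>2" using pos[OF x] by (simp_all add: S_def)
    have d1: "((\<lambda>x. sqrt (\<rho>\<^sup>2 - x\<^sup>2)) has_real_derivative (- (x / S))) (at x)"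
      unfolding S_def using pos[OF x] by (auto intro!: derivative_eq_intros simp: field_simps)
    have d2: "((\<lambda>x. arcsin (x / \<rho>)) has_real_derivative (1 / S)) (at x)"
    proof -
      have "((\<lambda>x. x / \<rho>) has_real_derivative (1 / \<rho>)) (at x)"
        using \<rho> by (auto intro!: derivative_eq_intros)
      from DERIV_chain2[OF DERIV_arcsin[OF b] this] show ?thesis
        using s \<rho> S(1) by (simp add: S_def)
    qed
    have "(T has_real_derivative (0 + ((1 * sqrt (\<rho>\<^sup>2 - x\<^sup>2) + (- (x / S)) * x) + \<rho>\<^sup>2 * (1 / S)) / (2 * h)))
        (at x)"
      unfolding T_def by (intro DERIV_add DERIV_cdivide DERIV_mult DERIV_cmult DERIV_const DERIV_ident d1 d2)
    then have "(T has_real_derivative ((S + x * (- (x / S))) + \<rho>\<^sup>2 * (1 / S)) / (2 * h)) (at x)"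
      by (simp add: S_def mult.commute)
    moreover have "((S + x * (- (x / S))) + \<rho>\<^sup>2 * (1 / S)) / (2 * h) = w x"
    proof -
      have "S + x * (- (x / S)) + \<rho>\<^sup>2 * (1 / S) = (S * S + (\<rho>\<^sup>2 - x\<^sup>2)) / S"
        using S(1) by (simp add: field_simps power2_eq_square)
      also have "\<dots> = 2 * S" using S by (simp add: S(2)[symmetric])
      finally have "S + x * (- (x / S)) + \<rho>\<^sup>2 * (1 / S) = 2 * S" .
      then show ?thesis by (simp only:) (simp add: w_def S_def)
    qed
    ultimately show ?thesis by simp
  qed
  have contT: "continuous_on {-\<rho>..\<rho>} T"
    unfolding T_def using \<rho> h
    by (intro continuous_intros) (auto simp: field_simps)
  \<comment> \<open>The derivative formula fails at the ends, where \<open>arcsin\<close> is not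
    differentiable; the comparison with the end values uses continuity there and the positive
    derivative inside.\<close>
  have "T x < T \<rho>" if "\<bar>x\<bar> < \<rho>" for x
  proof (rule DERIV_pos_imp_increasing_open[where f = T])
    show "x < \<rho>" using that by simp
    show "\<exists>y. (T has_real_derivative y) (at t) \<and> y > 0" if "x < t" "t < \<rho>" for t
      using dT w that \<open>\<bar>x\<bar> < \<rho>\<close> by (intro exI[of _ "w t"]) auto
    show "continuous_on {x..\<rho>} T" by (rule continuous_on_subset[OF contT]) (use that in auto)
  qed
  moreover have "T (- \<rho>) < T x" if "\<bar>x\<bar> < \<rho>" for x
  proof (rule DERIV_pos_imp_increasing_open[where f = T])
    show "- \<rho> < x" using that by simp
    show "\<exists>y. (T has_real_derivative y) (at t) \<and> y > 0" if "- \<rho> < t" "t < x" for t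
      using dT w that \<open>\<bar>x\<bar> < \<rho>\<close> by (intro exI[of _ "w t"]) auto
    show "continuous_on {-\<rho>..x} T" by (rule continuous_on_subset[OF contT]) (use that in auto)
  qed
  moreover have "T \<rho> < 1" "T (- \<rho>) > 0"
    using lt \<rho> h by (simp_all add: T_def field_simps)
  ultimately have T: "0 < T x \<and> T x < 1" if "\<bar>x\<bar> < \<rho>" for x
    using that by (smt (verit))
  show ?thesis
  proof (rule that[OF r\<rho>])
    have o: "open {-\<rho><..<\<rho>}" by simp
    show "smooth_on {-\<rho><..<\<rho>} w"
      unfolding w_def divide_inverse power2_eq_square
      using pos by (intro smooth_on_mult smooth_on_sqrt smooth_on_diff smooth_on_const smooth_on_id o)
        (auto simp: power2_eq_square abs_less_iff)
    show "0 < T x \<and> T x < 1 \<and> 0 < w x \<and> (T has_real_derivative w x) (at x)" if "\<bar>x\<bar> < \<rho>" for x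
      using T w dT that by blast
    show "\<bar>y\<bar> / w x < h" if xy: "x\<^sup>2 + y\<^sup>2 \<le> r\<^sup>2" for x y
    proof -
      have "y\<^sup>2 < \<rho>\<^sup>2 - x\<^sup>2" using xy R(1) \<rho>2 by linarith
      then have *: "\<bar>y\<bar> < sqrt (\<rho>\<^sup>2 - x\<^sup>2)" by (simp add: real_less_rsqrt)
      then have "sqrt (\<rho>\<^sup>2 - x\<^sup>2) > 0" by linarith
      then have "w x > 0" using h unfolding w_def by (rule divide_pos_pos)
      moreover have "\<bar>y\<bar> < h * w x" using * h by (simp add: w_def)
      ultimately show ?thesis by (simp add: field_simps)
    qed
  qed
qed

text \<open>In the coordinates \<open>t = exp s\<close>, \<open>Z = z - f q\<close> and \<open>p' = t * (p - P q)\<close> the symplectic form is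
  \<open>dt \<and> dZ + dq \<and> dp'\<close> and the cone over the graph of the 1-jet of \<open>f\<close> is \<open>Z = 0, p' = 0\<close>.\<close>

lemma ball_chart_symplectic:
  fixes f :: "'e::euclidean_space \<Rightarrow> real" and P :: "'e \<Rightarrow> 'e" and T w :: "real \<Rightarrow> real"
    and q0 :: 'e and \<epsilon> \<rho> :: real
  defines "F \<equiv> (\<lambda>u :: ('e \<times> real) \<times> ('e \<times> real). let q = q0 + \<epsilon> *\<^sub>R fst (fst u); t = T (snd (fst u)) in
      (ln t, ((q, P q + inverse (\<epsilon> * t) *\<^sub>R fst (snd u)), f q + snd (snd u) * inverse (w (snd (fst u))))))"
  assumes w: "smooth_on {-\<rho><..<\<rho>} w"
    and T: "\<And>x. \<bar>x\<bar> < \<rho> \<Longrightarrow> 0 < T x \<and> 0 < w x \<and> (T has_real_derivative w x) (at x)"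
    and V: "open V" "smooth_on V f" "smooth_on V P" "\<And>q v. q \<in> V \<Longrightarrow> fd f q v = P q \<bullet> v"
    and \<epsilon>: "\<epsilon> > 0" "\<And>x. norm x < \<rho> \<Longrightarrow> q0 + \<epsilon> *\<^sub>R x \<in> V"
  shows "smooth_on (ball 0 \<rho>) F"
    and "\<And>u v v'. u \<in> ball 0 \<rho> \<Longrightarrow>
      symplectization_form (F u) (fd F u v) (fd F u v') = standard_symplectic_form v v'"
proof -
  define N where "N = ball (0 :: ('e \<times> real) \<times> ('e \<times> real)) \<rho>"
  have N: "open N" by (simp add: N_def)
  define I where "I = {-\<rho><..<\<rho>}"
  have I: "open I" by (simp add: I_def)
  have T': "0 < T x" "0 < w x" "(T has_real_derivative w x) (at x)" if "x \<in> I" for x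
    using T[of x] that by (auto simp: I_def)
  have smT: "smooth_on I T"
  proof (rule smooth_on_derivativeI[OF I])
    show "(T has_derivative (\<lambda>v. w x * v)) (at x)" if "x \<in> I" for x
      using T'(3)[OF that] by (simp add: has_field_derivative_def)
    show "smooth_on I (\<lambda>x. w x * v)" for v
      using w by (intro smooth_on_mult smooth_on_const I) (simp add: I_def)
  qed
  define k where "k x = inverse (w x)" for x
  define k1 where "k1 x = fd k x 1" for x
  have smk: "smooth_on I k"
    unfolding k_def using w T'(2) by (intro smooth_on_inverse I) (force simp: I_def)+
  have smk1: "smooth_on I k1" unfolding k1_def by (rule smooth_on_fd[OF smk])
  have d1: "(g has_derivative (\<lambda>v. fd g x 1 * v)) (at x)" if "smooth_on I g" "x \<in> I" for g :: "real \<Rightarrow> real" and x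
  proof -
    note D = smooth_on_has_derivative[OF that]
    have "fd g x v = fd g x 1 * v" for v
      using linear_scale[OF has_derivative_linear[OF D], of v 1] by (simp add: mult.commute)
    then have "fd g x = (\<lambda>v. fd g x 1 * v)" by (rule ext)
    with D show ?thesis by (rule has_derivative_eq_rhs)
  qed
  have norms: "norm (fst (fst u)) < \<rho>" "snd (fst u) \<in> I" if "u \<in> N" for u
  proof -
    have "norm (fst u) < \<rho>" using that norm_fst_le[of "fst u" "snd u"] by (simp add: N_def)
    then show "norm (fst (fst u)) < \<rho>" "snd (fst u) \<in> I"
      using norm_fst_le[of "fst (fst u)" "snd (fst u)"] norm_snd_le[of "snd (fst u)" "fst (fst u)"]
      by (auto simp: I_def)
  qed
  have sm: "smooth_on N (\<lambda>u. fst (fst u))" "smooth_on N (\<lambda>u. snd (fst u))"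
    "smooth_on N (\<lambda>u. fst (snd u))" "smooth_on N (\<lambda>u. snd (snd u))"
    by (intro smooth_on_fst smooth_on_snd smooth_on_id N)+
  have xI: "(\<lambda>u. snd (fst u)) ` N \<subseteq> I" using norms by blast
  note compI = smooth_on_compose[OF N I xI sm(2)]
  define q where "q u = q0 + \<epsilon> *\<^sub>R fst (fst u)" for u :: "('e \<times> real) \<times> ('e \<times> real)"
  have qV: "q ` N \<subseteq> V" using norms \<epsilon>(2) by (auto simp: q_def)
  have smq: "smooth_on N q"
    unfolding q_def by (intro smooth_on_add smooth_on_scaleR smooth_on_const sm N)
  have F: "F = (\<lambda>u. (ln (T (snd (fst u))), ((q u, P (q u) + inverse (\<epsilon> * T (snd (fst u))) *\<^sub>R fst (snd u)),
      f (q u) + snd (snd u) * k (snd (fst u)))))"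
    by (simp add: F_def q_def k_def Let_def)
  have smF: "smooth_on N F"
    unfolding F
    by (intro smooth_on_Pair smooth_on_ln smooth_on_add smooth_on_scaleR smooth_on_inverse
        smooth_on_mult smooth_on_const N sm smq compI[OF smT] compI[OF smk]
        smooth_on_compose[OF N V(1) qV smq V(2)] smooth_on_compose[OF N V(1) qV smq V(3)])
      (use norms T'(1) \<epsilon>(1) in force)+
  then show "smooth_on (ball 0 \<rho>) F" by (simp add: N_def)
  \<comment> \<open>The pulled-back primitive. With \<open>u = ((x, X), (y, Y))\<close> it is T d(Y
    k) - y dx: the differential of \<open>f\<close> cancels the \<open>P\<close> part of the
    covector, and the factors \<open>t\<close> and \<open>\<epsilon>\<close> cancel against
    \<open>inverse (\<epsilon> * t)\<close>.\<close>
  define \<theta> where "\<theta> v u = T (snd (fst u)) * (snd (snd v) * k (snd (fst u)) +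
      snd (snd u) * (k1 (snd (fst u)) * snd (fst v))) - fst (snd u) \<bullet> fst (fst v)"
    for v u :: "('e \<times> real) \<times> ('e \<times> real)"
  have dx: "((\<lambda>u. g (snd (fst u))) has_derivative (\<lambda>v. g' * snd (fst v))) (at u)"
    if "(g has_derivative (\<lambda>v. g' * v)) (at (snd (fst u)))"
    for g :: "real \<Rightarrow> real" and g' and u :: "('e \<times> real) \<times> ('e \<times> real)"
    by (rule has_derivative_compose[of "\<lambda>u. snd (fst u)" "\<lambda>u. snd (fst u)" u UNIV g, OF _ that])
      (auto intro!: derivative_eq_intros)
  have dTx: "((\<lambda>u. T (snd (fst u))) has_derivative (\<lambda>v. w (snd (fst u)) * snd (fst v))) (at u)"
    and dk: "((\<lambda>u. k (snd (fst u))) has_derivative (\<lambda>v. k1 (snd (fst u)) * snd (fst v))) (at u)"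
    and dk1: "((\<lambda>u. k1 (snd (fst u))) has_derivative (\<lambda>v. fd k1 (snd (fst u)) 1 * snd (fst v))) (at u)"
    if "u \<in> N" for u
  proof -
    show "((\<lambda>u. T (snd (fst u))) has_derivative (\<lambda>v. w (snd (fst u)) * snd (fst v))) (at u)"
      using T'(3)[OF norms(2)[OF that]] by (intro dx) (simp add: has_field_derivative_def)
    show "((\<lambda>u. k (snd (fst u))) has_derivative (\<lambda>v. k1 (snd (fst u)) * snd (fst v))) (at u)"
      unfolding k1_def by (rule dx[OF d1[OF smk norms(2)[OF that]]])
    show "((\<lambda>u. k1 (snd (fst u))) has_derivative (\<lambda>v. fd k1 (snd (fst u)) 1 * snd (fst v))) (at u)"
      by (rule dx[OF d1[OF smk1 norms(2)[OF that]]])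
  qed
  have prim: "symplectization_primitive (F u) (fd F u v) = \<theta> v u" if u: "u \<in> N" for u v
  proof -
    have Tp: "T (snd (fst u)) > 0" using T'(1) norms(2)[OF u] by blast
    have qu: "q u \<in> V" using qV u by blast
    have dq: "(q has_derivative (\<lambda>v. \<epsilon> *\<^sub>R fst (fst v))) (at u)"
      unfolding q_def by (auto intro!: derivative_eq_intros)
    have "fst (fst (snd (fd F u v))) = fd q u v"
      using fd_bounded_linear[OF bounded_linear_jet_components(1) smooth_on_differentiable[OF smF u], of v]
      by (simp add: F)
    then have 1: "fst (fst (snd (fd F u v))) = \<epsilon> *\<^sub>R fst (fst v)"
      using fd_eq[OF dq] by simp
    have "(f has_derivative (\<lambda>v. P (q u) \<bullet> v)) (at (q u))"
      by (rule has_derivative_eq_rhs[OF smooth_on_has_derivative[OF V(2) qu]]) (simp add: fun_eq_iff V(4)[OF qu])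
    then have df: "((\<lambda>u. f (q u)) has_derivative (\<lambda>v. P (q u) \<bullet> (\<epsilon> *\<^sub>R fst (fst v)))) (at u)"
      by (rule has_derivative_compose[OF dq])
    have "snd (snd (fd F u v)) = fd (\<lambda>u. f (q u) + snd (snd u) * k (snd (fst u))) u v"
      using fd_bounded_linear[OF bounded_linear_jet_components(2) smooth_on_differentiable[OF smF u], of v]
      by (simp add: F)
    also have "\<dots> = P (q u) \<bullet> (\<epsilon> *\<^sub>R fst (fst v)) + (snd (snd v) * k (snd (fst u)) +
        snd (snd u) * (k1 (snd (fst u)) * snd (fst v)))"
      by (rule fd_eq) (auto intro!: derivative_eq_intros df dk[OF u])
    finally have 2: "snd (snd (fd F u v)) = \<dots>" .
    show ?thesis
      unfolding symplectization_primitive_eq 1 2 \<theta>_def using Tp \<epsilon>(1)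
      by (simp add: F inner_add_left field_simps)
  qed
  have d\<theta>: "fd (\<theta> v') u v = (w (snd (fst u)) * snd (fst v)) * (snd (snd v') * k (snd (fst u)) +
      snd (snd u) * (k1 (snd (fst u)) * snd (fst v'))) +
      T (snd (fst u)) * (snd (snd v') * (k1 (snd (fst u)) * snd (fst v)) +
        (snd (snd v) * (k1 (snd (fst u)) * snd (fst v')) +
         snd (snd u) * ((fd k1 (snd (fst u)) 1 * snd (fst v)) * snd (fst v')))) - fst (snd v) \<bullet> fst (fst v')"
    if u: "u \<in> N" for u v v'
    unfolding \<theta>_def
    by (rule fd_eq) (auto intro!: derivative_eq_intros dTx[OF u] dk[OF u] dk1[OF u] simp: algebra_simps)
  show "symplectization_form (F u) (fd F u v) (fd F u v') = standard_symplectic_form v v'"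
    if "u \<in> ball 0 \<rho>" for u v v'
  proof -
    have u: "u \<in> N" using that by (simp add: N_def)
    have "symplectization_form (F u) (fd F u v) (fd F u v') = fd (\<theta> v') u v - fd (\<theta> v) u v'"
      unfolding symplectization_form_pullback[OF N smF u]
      by (intro arg_cong2[where f = "(-)"] fun_cong[OF fd_cong_open[OF N u]] prim)
    \<comment> \<open>All terms containing \<open>k1\<close> or its derivative are symmetric in
      \<open>v\<close> and \<open>v'\<close> and drop out of the difference.\<close>
    also have "\<dots> = (w (snd (fst u)) * k (snd (fst u))) *
        (snd (fst v) * snd (snd v') - snd (fst v') * snd (snd v)) +
        (fst (snd v') \<bullet> fst (fst v) - fst (snd v) \<bullet> fst (fst v'))"
      unfolding d\<theta>[OF u] by (simp add: algebra_simps)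
    also have "w (snd (fst u)) * k (snd (fst u)) = 1"
      using T'(2)[OF norms(2)[OF u]] by (simp add: k_def)
    finally show ?thesis
      by (simp add: standard_symplectic_form_def split_beta inner_prod_def inner_commute algebra_simps)
  qed
qed

section \<open>Points of the jet space in coordinates\<close>

lemma proj_z_jet_chart: "snd (snd (jet_chart A c) y) = proj_z y"
  by (auto simp: jet_chart_def proj_z_def split_beta)

lemma proj_x_jet_chart: "fst (fst (snd (jet_chart A c) y)) = snd c (proj_x y)"
  by (auto simp: jet_chart_def proj_x_def split_beta)

lemma proj_x_in_chart: "y \<in> fst (jet_chart A c) \<Longrightarrow> proj_x y \<in> fst c"
  by (auto simp: jet_chart_def proj_x_def)

lemma jet_point_chart:
  assumes "smooth_manifold A" "c \<in> A" "q \<in> snd c ` fst c"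
  shows "jet_point A c ((q, p), z) \<in> fst (jet_chart A c)"
    and "snd (jet_chart A c) (jet_point A c ((q, p), z)) = ((q, p), z)"
    and "proj_x (jet_point A c ((q, p), z)) = inv_into (fst c) (snd c) q"
proof -
  have "inv_into (fst c) (snd c) q \<in> fst c" "snd c (inv_into (fst c) (snd c) q) = q"
    using assms(3) by (auto simp: inv_into_into f_inv_into_f)
  then show "jet_point A c ((q, p), z) \<in> fst (jet_chart A c)"
    "snd (jet_chart A c) (jet_point A c ((q, p), z)) = ((q, p), z)"
    "proj_x (jet_point A c ((q, p), z)) = inv_into (fst c) (snd c) q"
    using covector_in_cotangent_space[OF assms(1,2)] covector_base[OF assms(1,2)]
    by (simp_all add: jet_point_def Let_def jet_chart_def proj_x_def)
qed

lemma chart_inv_continuous: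
  assumes "smooth_manifold A" "c \<in> A"
  shows "continuous_map (top_of_set (snd c ` fst c)) (manifold_topology A) (inv_into (fst c) (snd c))"
proof -
  let ?g = "inv_into (fst c) (snd c)" and ?S = "snd c ` fst c"
  have oS: "open ?S" using smooth_manifold_chart[OF assms] by (simp add: is_chart_def)
  have "openin (top_of_set ?S) (?g -` {x \<in> fst d. snd d x \<in> W} \<inter> topspace (top_of_set ?S))"
    if "d \<in> A" "open W" for d W
  proof -
    have "?g -` {x \<in> fst d. snd d x \<in> W} \<inter> ?S = snd c ` (fst c \<inter> fst d) \<inter> transition c d -` W"
    proof (intro equalityI subsetI)
      fix q
      assume q: "q \<in> ?g -` {x \<in> fst d. snd d x \<in> W} \<inter> ?S"
      then have "?g q \<in> fst c" "q = snd c (?g q)" "?g q \<in> fst d"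
        by (auto simp: inv_into_into f_inv_into_f)
      then have "q \<in> snd c ` (fst c \<inter> fst d)" by blast
      with q show "q \<in> snd c ` (fst c \<inter> fst d) \<inter> transition c d -` W" by (simp add: transition_def)
    next
      fix q
      assume q: "q \<in> snd c ` (fst c \<inter> fst d) \<inter> transition c d -` W"
      then obtain x where "x \<in> fst c" "x \<in> fst d" "q = snd c x" by blast
      then have "?g q \<in> fst d" "q \<in> ?S"
        using chart_inv[OF smooth_manifold_chart[OF assms]] by auto
      with q show "q \<in> ?g -` {x \<in> fst d. snd d x \<in> W} \<inter> ?S" by (simp add: transition_def)
    qed
    moreover have "open (snd c ` (fst c \<inter> fst d) \<inter> transition c d -` W)"
      using smooth_manifold_transition[OF assms that(1)] that(2)
      by (intro continuous_open_preimage smooth_on_continuous)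
    ultimately show ?thesis by (auto simp: openin_open_eq[OF oS])
  qed
  moreover have "?g ` topspace (top_of_set ?S) \<subseteq> \<Union> {{x \<in> fst d. snd d x \<in> W} | d W. d \<in> A \<and> open W}"
  proof (rule image_subsetI)
    fix q
    assume "q \<in> topspace (top_of_set ?S)"
    then have "?g q \<in> {x \<in> fst c. snd c x \<in> UNIV}" by (auto simp: inv_into_into)
    then show "?g q \<in> \<Union> {{x \<in> fst d. snd d x \<in> W} | d W. d \<in> A \<and> open W}"
      using open_UNIV assms(2) by blast
  qed
  ultimately show ?thesis
    unfolding manifold_topology_def continuous_on_generated_topo_iff by blast
qed

section \<open>Reeb chords\<close>

lemma reeb_chord_carrier:
  assumes "reeb_chord A \<Lambda> a b \<gamma>" "t \<in> {a..b}"
  shows "\<gamma> t \<in> carrier (jet_atlas A)"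
  using assms
  by (auto simp: reeb_chord_def integral_curve_def continuous_map_def topspace_manifold_topology Pi_iff)

lemma reeb_chord_velocity:
  assumes "reeb_chord A \<Lambda> a b \<gamma>" "t \<in> {a..b}" "k \<in> jet_atlas A" "\<gamma> t \<in> fst k"
  shows "((snd k \<circ> \<gamma>) has_vector_derivative (0, 1)) (at t within {a..b})"
  using assms by (auto simp: reeb_chord_def integral_curve_def reeb_field_def)

text \<open>All jet charts share the same \<open>z\<close> coordinate, so the chartwise velocity of
  the chord gives \<open>proj_z (\<gamma> t) - t\<close> derivative zero on the whole
  interval.\<close>

lemma reeb_chord_proj_z:
  assumes "reeb_chord A \<Lambda> a b \<gamma>" "t \<in> {a..b}"
  shows "proj_z (\<gamma> t) = proj_z (\<gamma> a) + (t - a)"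
proof -
  note vd = reeb_chord_velocity[OF assms(1)]
  have ab: "a < b" using assms(1) by (simp add: reeb_chord_def)
  have "((\<lambda>t. proj_z (\<gamma> t) - t) has_derivative (\<lambda>h. 0)) (at t within {a..b})" if t: "t \<in> {a..b}" for t
  proof -
    note reeb_chord_carrier[OF assms(1) t]
    then obtain c where c: "c \<in> A" "\<gamma> t \<in> fst (jet_chart A c)"
      by (auto simp: carrier_def jet_atlas_eq)
    have "((\<lambda>t. snd ((snd (jet_chart A c) \<circ> \<gamma>) t)) has_vector_derivative snd ((0, 1) :: ('b \<times> 'b) \<times> real))
        (at t within {a..b})"
      by (rule bounded_linear.has_vector_derivative[OF bounded_linear_snd vd[OF t _ c(2)]])
        (simp add: jet_atlas_eq c(1))
    then have "((\<lambda>t. proj_z (\<gamma> t)) has_vector_derivative 1) (at t within {a..b})"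
      by (simp add: proj_z_jet_chart)
    from has_vector_derivative_diff[OF this has_vector_derivative_id] show ?thesis
      by (simp add: has_vector_derivative_def id_def)
  qed
  then have "\<exists>C. \<forall>t\<in>{a..b}. proj_z (\<gamma> t) - t = C"
    by (intro has_derivative_zero_constant) simp_all
  then obtain C where "\<And>t. t \<in> {a..b} \<Longrightarrow> proj_z (\<gamma> t) - t = C" by blast
  from this[OF assms(2)] this[of a] show ?thesis using ab by simp
qed

text \<open>Whichever chart \<open>SOME\<close> picks at \<open>t\<close>, the contact form takes
  the value 1 on the Reeb field, so the integrand is constant.\<close>

lemma reeb_chord_height:
  assumes "reeb_chord A \<Lambda> a b \<gamma>"
  shows "chord_height A a b \<gamma> = b - a"
proof -
  note vd = reeb_chord_velocity[OF assms(1)]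
  have ab: "a < b" using assms(1) by (simp add: reeb_chord_def)
  have "(let k = (SOME k. k \<in> jet_atlas A \<and> \<gamma> t \<in> fst k) in
      contact_form (snd k (\<gamma> t)) (vector_derivative (snd k \<circ> \<gamma>) (at t within {a..b}))) = 1"
    if t: "t \<in> {a..b}" for t
  proof -
    define k where "k = (SOME k. k \<in> jet_atlas A \<and> \<gamma> t \<in> fst k)"
    note reeb_chord_carrier[OF assms(1) t]
    then have "\<exists>k. k \<in> jet_atlas A \<and> \<gamma> t \<in> fst k" by (auto simp: carrier_def)
    then have "k \<in> jet_atlas A \<and> \<gamma> t \<in> fst k" unfolding k_def by (rule someI_ex)
    with vd[OF t] have "vector_derivative (snd k \<circ> \<gamma>) (at t within {a..b}) = (0, 1)"
      using vector_derivative_within_cbox[of a b t "snd k \<circ> \<gamma>" "(0, 1)"] ab t by auto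
    then show ?thesis
      unfolding k_def[symmetric] by (simp add: contact_form_def canonical_form_def split_beta)
  qed
  then have "chord_height A a b \<gamma> = integral {a..b} (\<lambda>t. 1 :: real)"
    unfolding chord_height_def line_integral_def by (intro integral_cong)
  then show ?thesis using ab by simp
qed

text \<open>A tube argument. The points of \<Lambda> in the closed slab that lie outside
  \<open>W\<close> form a compact set \<open>K\<close>; its projection is closed because the base is
  Hausdorff, and misses \<open>x0\<close> by the fiber condition. \<open>U\<close> is the complement
  of this projection, seen in \<open>c\<close>.\<close>

lemma fiber_neighbourhood:
  assumes M: "smooth_manifold A" "c \<in> A" and cpt: "compactin (manifold_topology (jet_atlas A)) \<Lambda>"
    and W: "openin (manifold_topology (jet_atlas A)) W" and x0: "x0 \<in> fst c"
    and fiber: "\<And>y. y \<in> \<Lambda> \<Longrightarrow> proj_x y = x0 \<Longrightarrow> \<bar>proj_z y - zc\<bar> \<le> h \<Longrightarrow> y \<in> W"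
  obtains U where "open U" "snd c x0 \<in> U" "U \<subseteq> snd c ` fst c"
    "\<And>y. y \<in> \<Lambda> \<Longrightarrow> proj_x y \<in> fst c \<Longrightarrow> snd c (proj_x y) \<in> U \<Longrightarrow> \<bar>proj_z y - zc\<bar> \<le> h \<Longrightarrow> y \<in> W"
proof -
  let ?J = "manifold_topology (jet_atlas A)" and ?M = "manifold_topology A"
  define K where "K = (topspace ?J - W) \<inter> {y \<in> topspace ?J. proj_z y \<in> cball zc h} \<inter> \<Lambda>"
  have "closedin ?J (topspace ?J - W)" using W by blast
  moreover have "closedin ?J {y \<in> topspace ?J. proj_z y \<in> cball zc h}"
    by (rule closedin_continuous_map_preimage[OF continuous_map_proj_z]) simp
  ultimately have "compactin ?J K"
    unfolding K_def by (intro closed_Int_compactin closedin_Int cpt)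
  then have "compactin ?M (proj_x ` K)" using image_compactin continuous_map_proj_x by blast
  moreover have "Hausdorff_space ?M" using M(1) by (simp add: smooth_manifold_def)
  ultimately have "closedin ?M (proj_x ` K)" using compactin_imp_closedin by blast
  then have oX: "openin ?M (topspace ?M - proj_x ` K)" by blast
  have \<Lambda>: "\<Lambda> \<subseteq> topspace ?J" using cpt by (simp add: compactin_def)
  have K: "y \<in> K \<longleftrightarrow> y \<in> \<Lambda> \<and> y \<notin> W \<and> \<bar>proj_z y - zc\<bar> \<le> h" for y
    using \<Lambda> by (auto simp: K_def dist_real_def abs_minus_commute)
  have c: "is_chart c" using smooth_manifold_chart[OF M] .
  then have oS: "open (snd c ` fst c)" by (simp add: is_chart_def)
  define U where "U = {q \<in> snd c ` fst c. inv_into (fst c) (snd c) q \<in> topspace ?M - proj_x ` K}"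
  show ?thesis
  proof (rule that)
    have "openin (top_of_set (snd c ` fst c)) U"
      using openin_continuous_map_preimage[OF chart_inv_continuous[OF M] oX] by (simp add: U_def)
    then show "open U" using openin_open_eq[OF oS] by blast
    have "x0 \<notin> proj_x ` K" using fiber K by blast
    moreover have "x0 \<in> topspace ?M" using M(2) x0 by (auto simp: topspace_manifold_topology carrier_def)
    ultimately show "snd c x0 \<in> U" using x0 by (simp add: U_def chart_inv[OF c])
    show "U \<subseteq> snd c ` fst c" by (auto simp: U_def)
    show "y \<in> W" if "y \<in> \<Lambda>" "proj_x y \<in> fst c" "snd c (proj_x y) \<in> U" "\<bar>proj_z y - zc\<bar> \<le> h" for y
    proof (rule ccontr)
      assume "y \<notin> W"
      then have "y \<in> K" using that K by blast
      moreover have "proj_x y \<notin> proj_x ` K" using that(3) by (simp add: U_def chart_inv[OF c that(2)])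
      ultimately show False by blast
    qed
  qed
qed

lemma ball_area_le_relative_gromov_width:
  fixes A :: "('m, 'e::euclidean_space) chart set"
  assumes M: "smooth_manifold A" and \<Lambda>: "closed_legendrian A \<Lambda>"
    and y0: "y0 \<in> \<Lambda>" "front_proj y0 \<notin> front_singularities A \<Lambda>"
    and fiber: "\<And>y. y \<in> \<Lambda> \<Longrightarrow> proj_x y = proj_x y0 \<Longrightarrow> \<bar>proj_z y - proj_z y0\<bar> < h \<Longrightarrow> y = y0"
    and r: "r > 0" "pi * r\<^sup>2 < 2 * h"
  shows "ereal (pi * r\<^sup>2) \<le> relative_gromov_width A \<Lambda>"
proof -
  have leg: "legendrian A \<Lambda>" and cpt: "compactin (manifold_topology (jet_atlas A)) \<Lambda>"
    using \<Lambda> by (simp_all add: closed_legendrian_def)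
  have "y0 \<in> carrier (jet_atlas A)"
    using compactin_subset_topspace[OF cpt] y0(1) by (auto simp: topspace_manifold_topology)
  then obtain c where "c \<in> A" "y0 \<in> fst (jet_chart A c)" by (auto simp: carrier_def jet_atlas_eq)
  then have c: "c \<in> A" "proj_x y0 \<in> fst c" by (simp_all add: proj_x_in_chart)
  define q0 where "q0 = snd c (proj_x y0)"
  obtain V f P W where V: "open V" "q0 \<in> V" "V \<subseteq> snd c ` fst c" "smooth_on V f" "smooth_on V P"
    "\<And>q v. q \<in> V \<Longrightarrow> fd f q v = P q \<bullet> v" "f q0 = proj_z y0"
    "\<And>q. q \<in> V \<Longrightarrow> \<exists>y\<in>\<Lambda>. y \<in> fst (jet_chart A c) \<and> snd (jet_chart A c) y = ((q, P q), f q)"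
    and W: "openin (manifold_topology (jet_atlas A)) W" "y0 \<in> W"
    "\<And>y. y \<in> \<Lambda> \<inter> W \<Longrightarrow> y \<in> fst (jet_chart A c) \<and> (\<exists>q\<in>V. snd (jet_chart A c) y = ((q, P q), f q))"
    using legendrian_local_graph[OF M c(1) leg y0(1) c(2) y0(2)] unfolding q0_def by blast
  \<comment> \<open>The slack between the area and \<open>2 * h\<close> is split in two:
    \<open>h1\<close> bounds the image in the \<open>Z\<close> direction and \<open>h2 - h1\<close>
    the variation of \<open>f\<close> below it. The strict \<open>h2 < h\<close> turns the open
    fiber condition into one on a closed slab, as compactness requires.\<close>
  obtain h1 where h1: "pi * r\<^sup>2 / 2 < h1" "h1 < h" using r(2) dense[of "pi * r\<^sup>2 / 2" h] by auto
  obtain h2 where h2: "h1 < h2" "h2 < h" using dense[OF h1(2)] by blast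
  obtain \<rho> T w where \<rho>: "r < \<rho>" "smooth_on {-\<rho><..<\<rho>} w"
    and T: "\<And>x. \<bar>x\<bar> < \<rho> \<Longrightarrow> 0 < T x \<and> T x < 1 \<and> 0 < w x \<and> (T has_real_derivative w x) (at x)"
    and wh: "\<And>x y. x\<^sup>2 + y\<^sup>2 \<le> r\<^sup>2 \<Longrightarrow> \<bar>y\<bar> / w x < h1"
  proof (rule disk_into_rectangle[OF r(1)])
    show "pi * r\<^sup>2 < 2 * h1" using h1(1) by simp
  qed (rule that)
  obtain U where U: "open U" "q0 \<in> U" "U \<subseteq> snd c ` fst c"
    "\<And>y. y \<in> \<Lambda> \<Longrightarrow> proj_x y \<in> fst c \<Longrightarrow> snd c (proj_x y) \<in> U \<Longrightarrow> \<bar>proj_z y - proj_z y0\<bar> \<le> h2 \<Longrightarrow> y \<in> W"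
  proof (rule fiber_neighbourhood[OF M c(1) cpt W(1) c(2), of "proj_z y0" h2, folded q0_def])
    show "y \<in> W" if "y \<in> \<Lambda>" "proj_x y = proj_x y0" "\<bar>proj_z y - proj_z y0\<bar> \<le> h2" for y
      using fiber[OF that(1,2)] that(3) h2(2) W(2) by auto
  qed (rule that)
  \<comment> \<open>Over \<open>X\<close> the graph is defined, the slab of half-height
    \<open>h2\<close> contains no other part of \<Lambda>, and \<open>f\<close> stays within
    \<open>h2 - h1\<close> of the height of \<open>y0\<close>.\<close>
  define X where "X = V \<inter> U \<inter> (V \<inter> f -` ball (proj_z y0) (h2 - h1))"
  have "open X"
    unfolding X_def using continuous_open_preimage[OF smooth_on_continuous[OF V(4)] V(1) open_ball] V(1) U(1)
    by blast
  moreover have "q0 \<in> X" using V U h2 by (simp add: X_def)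
  ultimately obtain \<eta> where \<eta>: "\<eta> > 0" "ball q0 \<eta> \<subseteq> X" by (meson openE)
  \<comment> \<open>Scales the base coordinates of the ball of radius \<open>\<rho>\<close> into the
    ball of radius \<open>\<eta>\<close> around \<open>q0\<close>.\<close>
  define \<epsilon> where "\<epsilon> = \<eta> / \<rho>"
  have \<rho>0: "\<rho> > 0" using \<rho>(1) r(1) by linarith
  have \<epsilon>: "\<epsilon> > 0" using \<eta>(1) \<rho>0 by (simp add: \<epsilon>_def)
  have qX: "q0 + \<epsilon> *\<^sub>R x \<in> X" if "norm x < \<rho>" for x
  proof -
    have "\<epsilon> * norm x < \<epsilon> * \<rho>" using that \<epsilon> by simp
    also have "\<dots> = \<eta>" using \<rho>0 by (simp add: \<epsilon>_def)
    finally show ?thesis using \<eta>(2) \<epsilon> by (auto simp: subset_iff dist_norm)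
  qed
  have XV: "X \<subseteq> V" by (auto simp: X_def)
  define F where "F = (\<lambda>u :: ('e \<times> real) \<times> ('e \<times> real). let q = q0 + \<epsilon> *\<^sub>R fst (fst u); t = T (snd (fst u)) in
      (ln t, ((q, P q + inverse (\<epsilon> * t) *\<^sub>R fst (snd u)), f q + snd (snd u) * inverse (w (snd (fst u))))))"
  have T0: "\<And>x. \<bar>x\<bar> < \<rho> \<Longrightarrow> 0 < T x \<and> 0 < w x \<and> (T has_real_derivative w x) (at x)"
    using T by blast
  have qV: "\<And>x. norm x < \<rho> \<Longrightarrow> q0 + \<epsilon> *\<^sub>R x \<in> V" using qX XV by blast
  have smF: "smooth_on (ball 0 \<rho>) F"
    using ball_chart_symplectic(1)[OF \<rho>(2) T0 V(1,4,5,6) \<epsilon> qV] by (simp only: F_def)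
  have sympF: "symplectization_form (F u) (fd F u v) (fd F u v') = standard_symplectic_form v v'"
    if "u \<in> ball 0 \<rho>" for u v v'
    using ball_chart_symplectic(2)[OF \<rho>(2) T0 V(1,4,5,6) \<epsilon> qV that] by (simp only: F_def)
  define \<psi> where "\<psi> u = (fst (F u), jet_point A c (snd (F u)))" for u
  have norms: "norm (fst (fst u)) < \<rho>" "\<bar>snd (fst u)\<bar> < \<rho>" if "u \<in> ball 0 \<rho>" for u :: "('e \<times> real) \<times> ('e \<times> real)"
  proof -
    have "norm (fst u) < \<rho>" using that norm_fst_le[of "fst u" "snd u"] by simp
    then show "norm (fst (fst u)) < \<rho>" "\<bar>snd (fst u)\<bar> < \<rho>"
      using norm_fst_le[of "fst (fst u)" "snd (fst u)"] norm_snd_le[of "snd (fst u)" "fst (fst u)"]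
      by auto
  qed
  have Fneg: "fst (F u) < 0" and Fq: "fst (fst (snd (F u))) = q0 + \<epsilon> *\<^sub>R fst (fst u)"
    and FX: "fst (fst (snd (F u))) \<in> X" if "u \<in> ball 0 \<rho>" for u
    using T[OF norms(2)[OF that]] qX[OF norms(1)[OF that]] by (simp_all add: F_def Let_def)
  have XC: "X \<subseteq> snd c ` fst c" using XV V(3) by blast
  have jp: "jet_point A c (snd (F u)) \<in> fst (jet_chart A c)"
    "snd (jet_chart A c) (jet_point A c (snd (F u))) = snd (F u)"
    "proj_x (jet_point A c (snd (F u))) = inv_into (fst c) (snd c) (fst (fst (snd (F u))))"
    if "u \<in> ball 0 \<rho>" for u
    using jet_point_chart[OF M c(1), of "fst (fst (snd (F u)))" "snd (fst (snd (F u)))" "snd (snd (F u))"]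
      FX[OF that] XC by auto
  have ball: "cball 0 r \<subseteq> ball (0 :: ('e \<times> real) \<times> ('e \<times> real)) \<rho>" using \<rho>(1) by auto
  have Fc: "fst (F u) < 0 \<and> fst (fst (snd (F u))) \<in> snd c ` fst c" if "u \<in> ball 0 \<rho>" for u
    using Fneg[OF that] FX[OF that] XC by blast
  have emb: "symplectic_ball_embedding A r \<psi>"
    unfolding symplectic_ball_embedding_def
  proof (intro conjI ballI impI allI)
    show "\<exists>N. cball 0 r \<subseteq> N \<and> smooth_into (neg_symplectization_atlas A) N \<psi>"
      using ball smooth_into_chart_expression(1)[OF M c(1) open_ball smF Fc \<psi>_def] by blast
    fix u k v v'
    assume u: "u \<in> cball 0 r" and k: "k \<in> neg_symplectization_atlas A" "\<psi> u \<in> fst k"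
    then have "u \<in> ball 0 \<rho>" using ball by blast
    then show "symplectization_form (snd k (\<psi> u)) (fd (snd k \<circ> \<psi>) u v) (fd (snd k \<circ> \<psi>) u v') =
        standard_symplectic_form v v'"
      using smooth_into_chart_expression(2)[OF M c(1) open_ball smF Fc \<psi>_def _ k] sympF by simp
  next
    show "inj_on \<psi> (cball 0 r)"
    proof (rule inj_onI)
      fix u u'
      assume u: "u \<in> cball 0 r" "u' \<in> cball 0 r" and eq: "\<psi> u = \<psi> u'"
      have ub: "u \<in> ball 0 \<rho>" "u' \<in> ball 0 \<rho>" using u ball by blast+
      have "fst (F u) = fst (F u')" "jet_point A c (snd (F u)) = jet_point A c (snd (F u'))"
        using eq by (simp_all add: \<psi>_def)
      with jp(2)[OF ub(1)] jp(2)[OF ub(2)] have FF: "F u = F u'" by (simp add: prod_eq_iff)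
      have "ln (T (snd (fst u))) = ln (T (snd (fst u')))" using FF by (simp add: F_def Let_def)
      then have TT: "T (snd (fst u)) = T (snd (fst u'))"
        using T[OF norms(2)[OF ub(1)]] T[OF norms(2)[OF ub(2)]] by simp
      \<comment> \<open>\<open>T\<close> has positive derivative, so the symplectization coordinate
        determines \<open>snd (fst u)\<close>; given it, the other coordinates are recovered one
        after the other, dividing by \<open>\<epsilon>\<close>, \<open>\<epsilon> * T\<close> or
        \<open>1 / w\<close>.\<close>
      have mono: "T x < T x'" if "\<bar>x\<bar> < \<rho>" "\<bar>x'\<bar> < \<rho>" "x < x'" for x x'
      proof (rule DERIV_pos_imp_increasing[where f = T, OF that(3)])
        show "\<exists>y. (T has_real_derivative y) (at t) \<and> 0 < y" if "x \<le> t" "t \<le> x'" for t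
          using T[of t] that \<open>\<bar>x\<bar> < \<rho>\<close> \<open>\<bar>x'\<bar> < \<rho>\<close> by (intro exI[of _ "w t"]) auto
      qed
      have x: "snd (fst u) = snd (fst u')"
        using mono[OF norms(2)[OF ub(1)] norms(2)[OF ub(2)]] mono[OF norms(2)[OF ub(2)] norms(2)[OF ub(1)]] TT
        by (metis less_irrefl linorder_neqE)
      have x': "fst (fst u) = fst (fst u')" using Fq[OF ub(1)] Fq[OF ub(2)] FF \<epsilon> by simp
      have Tw: "T (snd (fst u')) > 0" "w (snd (fst u')) > 0" using T[OF norms(2)[OF ub(2)]] by blast+
      have "fst (snd u) = fst (snd u')" "snd (snd u) = snd (snd u')"
        using FF \<epsilon> Tw by (simp_all add: F_def Let_def x x')
      with x x' show "u = u'" by (simp add: prod_eq_iff)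
    qed
  qed
  have "{u \<in> cball 0 r. \<psi> u \<in> {..<0} \<times> \<Lambda>} = cball 0 r \<inter> real_plane"
  proof -
    have "\<psi> u \<in> {..<0} \<times> \<Lambda> \<longleftrightarrow> u \<in> real_plane" if u: "u \<in> cball 0 r" for u
    proof -
      have ub: "u \<in> ball 0 \<rho>" using u ball by blast
      define q where "q = q0 + \<epsilon> *\<^sub>R fst (fst u)"
      define y where "y = jet_point A c (snd (F u))"
      note T' = T[OF norms(2)[OF ub]]
      have q: "q \<in> X" using qX[OF norms(1)[OF ub]] by (simp add: q_def)
      have snF: "snd (F u) = ((q, P q + inverse (\<epsilon> * T (snd (fst u))) *\<^sub>R fst (snd u)),
          f q + snd (snd u) * inverse (w (snd (fst u))))"
        by (simp add: F_def Let_def q_def)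
      have y: "y \<in> fst (jet_chart A c)" "snd (jet_chart A c) y = snd (F u)"
        using jp[OF ub] by (simp_all add: y_def)
      show ?thesis
      proof
        assume "\<psi> u \<in> {..<0} \<times> \<Lambda>"
        then have y\<Lambda>: "y \<in> \<Lambda>" by (simp add: \<psi>_def y_def)
        \<comment> \<open>For the height only the projection of the ball to the plane of
          \<open>snd (fst u)\<close> and \<open>snd (snd u)\<close> matters, and this is contained
          in the disk of radius \<open>r\<close>.\<close>
        have "(snd p)\<^sup>2 \<le> (norm p)\<^sup>2" for p :: "'e \<times> real"
          using power_mono[OF norm_snd_le[of "snd p" "fst p"] norm_ge_zero, of 2] by simp
        then have "(snd (fst u))\<^sup>2 + (snd (snd u))\<^sup>2 \<le> (norm (fst u))\<^sup>2 + (norm (snd u))\<^sup>2"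
          by (intro add_mono)
        also have "\<dots> = (norm u)\<^sup>2" by (simp add: norm_prod_def)
        also have "\<dots> \<le> r\<^sup>2" using u by (simp add: power_mono)
        finally have "\<bar>snd (snd u)\<bar> / w (snd (fst u)) < h1" by (rule wh)
        then have "\<bar>snd (snd u) * inverse (w (snd (fst u)))\<bar> < h1"
          using T' by (simp add: abs_mult divide_inverse)
        moreover have "\<bar>f q - proj_z y0\<bar> < h2 - h1"
          using q by (simp add: X_def dist_real_def abs_minus_commute)
        moreover have "proj_z y = f q + snd (snd u) * inverse (w (snd (fst u)))"
          using proj_z_jet_chart[of A c y] y(2) by (simp add: snF)
        ultimately have "\<bar>proj_z y - proj_z y0\<bar> \<le> h2" by linarith
        moreover have "snd c (proj_x y) \<in> U"
          using proj_x_jet_chart[of A c y] y(2) q by (simp add: snF X_def)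
        \<comment> \<open>Inside the slab over \<open>U\<close> the point can only lie on the graph.
          Comparing base coordinates gives \<open>q' = q\<close>, and then both remaining
          coordinates of \<open>u\<close> must vanish.\<close>
        ultimately have "y \<in> W" using U(4)[OF y\<Lambda> proj_x_in_chart[OF y(1)]] by blast
        with W(3)[of y] y\<Lambda> obtain q' where "snd (F u) = ((q', P q'), f q')" using y(2) by auto
        then have "inverse (\<epsilon> * T (snd (fst u))) *\<^sub>R fst (snd u) = 0"
          "snd (snd u) * inverse (w (snd (fst u))) = 0"
          by (auto simp: snF)
        then have "fst (snd u) = 0" "snd (snd u) = 0" using T' \<epsilon> by simp_all
        then show "u \<in> real_plane" by (simp add: real_plane_def split_beta prod_eq_iff)
      next
        assume "u \<in> real_plane"
        then have "snd u = 0" by (auto simp: real_plane_def)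
        then have "snd (F u) = ((q, P q), f q)" by (simp add: snF)
        moreover have "q \<in> V" using q XV by blast
        \<comment> \<open>The point of \<Lambda> over \<open>q\<close> has the jet coordinates of
          \<open>y\<close>; injectivity of the jet chart identifies the two.\<close>
        ultimately obtain y' where y': "y' \<in> \<Lambda>" "y' \<in> fst (jet_chart A c)"
          "snd (jet_chart A c) y' = snd (jet_chart A c) y"
          using V(8) y(2) by metis
        have "y' = y" using inj_onD[OF jet_chart_inj[OF M c(1)] y'(3,2) y(1)] .
        then show "\<psi> u \<in> {..<0} \<times> \<Lambda>" using y'(1) Fneg[OF ub] by (simp add: \<psi>_def y_def)
      qed
    qed
    then show ?thesis
      by (simp only: set_eq_iff mem_Collect_eq Int_iff simp_thms cong: conj_cong)
  qed
  with emb r(1) show ?thesis unfolding relative_gromov_width_def by (intro Sup_upper) blast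
qed

text \<open>The width is a supremum, so it is enough to reach every positive \<open>e\<close> below
  \<open>2 * h\<close>, with \<open>r\<close> solving \<open>pi * r\<^sup>2 = e\<close>; no ball of
  the limiting size is constructed.\<close>

lemma relative_gromov_width_ge:
  fixes A :: "('m, 'e::euclidean_space) chart set"
  assumes "smooth_manifold A" "closed_legendrian A \<Lambda>"
    and "y0 \<in> \<Lambda>" "front_proj y0 \<notin> front_singularities A \<Lambda>" "h > 0"
    and "\<And>y. y \<in> \<Lambda> \<Longrightarrow> proj_x y = proj_x y0 \<Longrightarrow> \<bar>proj_z y - proj_z y0\<bar> < h \<Longrightarrow> y = y0"
  shows "ereal (2 * h) \<le> relative_gromov_width A \<Lambda>"
proof (rule dense_le_bounded[of 0])
  show "0 < ereal (2 * h)" using assms(5) by simp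
  fix a :: ereal
  assume a: "0 < a" "a < ereal (2 * h)"
  then obtain e where e: "a = ereal e" by (cases a) auto
  define r where "r = sqrt (e / pi)"
  have "e > 0" "e < 2 * h" using a by (simp_all add: e)
  then have r: "r > 0" "pi * r\<^sup>2 = e" by (simp_all add: r_def)
  with ball_area_le_relative_gromov_width[OF assms(1-4,6) r(1)] \<open>e < 2 * h\<close>
  show "a \<le> relative_gromov_width A \<Lambda>" by (simp add: e)
qed

theorem theorem1p2:
  fixes A :: "('m, 'e::euclidean_space) chart set"
    and \<Lambda> :: "('m, 'e) jet set"
    and \<gamma> :: "real \<Rightarrow> ('m, 'e) jet"
    and a b h :: real
  assumes "smooth_manifold A"
    and "closed_legendrian A \<Lambda>"
    and "reeb_chord A \<Lambda> a b \<gamma>"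
    and "frontwise_doubly_extendable A \<Lambda> a b \<gamma>"
    and "chord_height A a b \<gamma> = h"
  shows "ereal (2 * h) \<le> relative_gromov_width A \<Lambda>"
proof -
  have h: "h = b - a" using reeb_chord_height[OF assms(3)] assms(5) by simp
  have ab: "a < b" and \<gamma>: "\<gamma> a \<in> \<Lambda>" "\<gamma> b \<in> \<Lambda>" using assms(3) by (simp_all add: reeb_chord_def)
  define za where "za = proj_z (\<gamma> a)"
  have z: "proj_z (\<gamma> t) = za + (t - a)" if "t \<in> {a..b}" for t
    using reeb_chord_proj_z[OF assms(3) that] by (simp add: za_def)
  obtain x0 zm zp where x0: "proj_x ` \<gamma> ` {a..b} = {x0}" and zmp: "zm \<le> zp" "proj_z ` \<gamma> ` {a..b} = {zm..zp}"
    and ext: "front_proj -` ({x0} \<times> {zm - (zp - zm)..zp}) \<inter> \<Lambda> = \<Lambda> \<inter> {\<gamma> a, \<gamma> b} \<or>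
      front_proj -` ({x0} \<times> {zm..zp + (zp - zm)}) \<inter> \<Lambda> = \<Lambda> \<inter> {\<gamma> a, \<gamma> b}"
    and sing: "{\<gamma> a, \<gamma> b} \<inter> front_proj -` front_singularities A \<Lambda> = {}"
    using assms(4) unfolding frontwise_doubly_extendable_def Let_def by blast
  have "proj_z ` \<gamma> ` {a..b} = (\<lambda>t. (za - a) + t) ` {a..b}"
    unfolding image_image by (rule image_cong) (simp_all add: z)
  also have "\<dots> = {za..za + h}" unfolding image_add_atLeastAtMost by (simp add: h)
  finally have "{zm..zp} = {za..za + h}" using zmp(2) by simp
  then have zz: "zm = za" "zp = za + h" using zmp(1) by (auto simp: Icc_eq_Icc)
  have zb: "proj_z (\<gamma> b) = za + h" using z[of b] ab by (simp add: h)
  have x: "proj_x (\<gamma> a) = x0" "proj_x (\<gamma> b) = x0"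
  proof -
    have "proj_x (\<gamma> t) = x0" if "t \<in> {a..b}" for t
      using that x0 by blast
    then show "proj_x (\<gamma> a) = x0" "proj_x (\<gamma> b) = x0" using ab by simp_all
  qed
  have h0: "h > 0" using ab by (simp add: h)
  from ext show ?thesis
  proof
    \<comment> \<open>The interval is \<open>{za - h..za + h}\<close>, centred at the lower end of
      the chord. The upper end lies at distance exactly \<open>h\<close> and is excluded by the
      strict inequality.\<close>
    assume *: "front_proj -` ({x0} \<times> {zm - (zp - zm)..zp}) \<inter> \<Lambda> = \<Lambda> \<inter> {\<gamma> a, \<gamma> b}"
    show ?thesis
    proof (rule relative_gromov_width_ge[OF assms(1,2) \<gamma>(1) _ h0])
      show "front_proj (\<gamma> a) \<notin> front_singularities A \<Lambda>" using sing by auto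
      fix y
      assume y: "y \<in> \<Lambda>" "proj_x y = proj_x (\<gamma> a)" "\<bar>proj_z y - proj_z (\<gamma> a)\<bar> < h"
      then have "y \<in> front_proj -` ({x0} \<times> {zm - (zp - zm)..zp}) \<inter> \<Lambda>"
        by (auto simp: front_proj_def x zz za_def[symmetric])
      then have "y = \<gamma> a \<or> y = \<gamma> b" unfolding * by blast
      then show "y = \<gamma> a" using y(3) zb by (auto simp: za_def[symmetric])
    qed
  next
    \<comment> \<open>The mirror case: \<open>{za..za + 2 * h}\<close> is centred at the upper end
      of the chord.\<close>
    assume *: "front_proj -` ({x0} \<times> {zm..zp + (zp - zm)}) \<inter> \<Lambda> = \<Lambda> \<inter> {\<gamma> a, \<gamma> b}"
    show ?thesis
    proof (rule relative_gromov_width_ge[OF assms(1,2) \<gamma>(2) _ h0])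
      show "front_proj (\<gamma> b) \<notin> front_singularities A \<Lambda>" using sing by auto
      fix y
      assume y: "y \<in> \<Lambda>" "proj_x y = proj_x (\<gamma> b)" "\<bar>proj_z y - proj_z (\<gamma> b)\<bar> < h"
      then have "y \<in> front_proj -` ({x0} \<times> {zm..zp + (zp - zm)}) \<inter> \<Lambda>"
        by (auto simp: front_proj_def x zz zb)
      then have "y = \<gamma> a \<or> y = \<gamma> b" unfolding * by blast
      then show "y = \<gamma> b" using y(3) zb by (auto simp: za_def[symmetric])
    qed
  qed
qed

end
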